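(* Let $n\ge1$ and $\delta=(n,n-1,\ldots,1)$. Then $$\begin{aligned}(1+t)^{n^2}&=\sum_{ST\in\mathcal{ST}^{\delta}(n,\overline n)}t^{\mathrm{var}(ST)+\mathrm{bar}(ST)}(1+t)^{\mathrm{str}(ST)-n}\\&=\sum_{UA\in\mathcal{UA}^{\delta}(2n)}t^{\mathrm{ssi}(UA)+\mathrm{bar}(UA)}(1+t)^{\mathrm{neg}(UA)}\\&=\sum_{CM\in\mathcal{CM}^{\delta}(2n)}t^{\mathrm{ne}_o(CM)+\mathrm{se}_e(CM)+\mathrm{wgt}_e(CM)}(1+t)^{\mathrm{ns}(CM)}.\end{aligned}$$
   Context: Here $t$ is an indeterminate. Let $[n,\overline n]=\{1,\ldots,n\}\cup\{\overline1,\ldots,\overline n\}$ be ordered by $\overline1<1<\overline2<2<\cdots<\overline n<n$. Matrix rows are numbered from the top, columns from the left. Shifted tableaux: $SF^\delta=\{(i,j):1\le i\le j\le n\}$. $\mathcal{ST}^\delta(n,\overline n)$ is the set of fillings $ST=(\eta_{ij})_{(i,j)\in SF^\delta}$ with $\eta_{ij}\in[n,\overline n]$, $\eta_{ii}\in\{i,\overline i\}$, $\eta_{ij}\le\eta_{i,j+1}$, $\eta_{ij}\le\eta_{i+1,j}$, $\eta_{ij}<\eta_{i+1,j+1}$ whenever the boxes lie in $SF^\delta$. For $c\in[n,\overline n]$, $\mathrm{con}_c(ST)$ is the number of connected components of the set of boxes with entry $c$ (boxes being adjacent when they share an edge; $0$ if there are none). $\mathrm{str}(ST)=\sum_{c}\mathrm{con}_c(ST)$;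 $\mathrm{bar}(ST)$ is the number of barred entries; $\mathrm{row}_k(ST)$ is the number of rows containing an entry $k$; $\mathrm{col}_{\overline k}(ST)$ is the number of columns containing an entry $\overline k$; and $\mathrm{var}(ST)=\sum_{k=1}^n\big(\mathrm{row}_k(ST)-\mathrm{con}_k(ST)+\mathrm{col}_{\overline k}(ST)-\mathrm{con}_{\overline k}(ST)\big)$. U-turn matrices: $\mathcal{UA}^\delta(2n)$ is the set of $2n\times n$ matrices $UA=(a_{iq})$ with: $a_{iq}\in\{-1,0,1\}$; $\sum_{q=p}^n a_{iq}\in\{0,1\}$ for $1\le i\le 2n$, $1\le p\le n$; $\sum_{i=j}^{2n}a_{iq}\in\{0,1\}$ for $1\le j\le 2n$, $1\le q\le n$; $\sum_{q=1}^n(a_{2i-1,q}+a_{2i,q})=1$ for $1\le i\le n$; and $\sum_{i=1}^{2n}a_{iq}=1$ for $1\le q\le n$. A zero entry is positive if the nearest non-zero entry to its right in the same row exists and equals $1$. $\mathrm{neg}(UA)$ is the number of entries $-1$; $\mathrm{bar}(UA)$ is the total number of $1$'s and positive zeros in even-numbered rows; $\mathrm{ssi}(UA)$ is the number of positions $(i,q)$ holding a positive zero such that either $i$ is odd and the nearest non-zero entry below $(i,q)$ in column $q$ exists and equals $1$, or $i$ is even and the nearest non-zero entry below $(i,q)$ in column $q$ either equals $-1$ or does not exist. Square ice configuration matrices: consider the $2n\times n$ grid of internal vertices, each with four edges (up, down, left, right), shared with the neighbouring vertex or, at the border, a boundary edge. Orient all edges so that each internal vertex has exactly two incoming and two outgoing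 edges, and: every right boundary edge is incoming (points into the grid); every bottom and every top boundary edge is outgoing; for each $1\le i\le n$, exactly one of the left boundary edges of rows $2i-1$ and $2i$ is incoming and the other outgoing. To each such orientation associate the $2n\times n$ matrix $CM$ whose element at each vertex is: WE if the incoming edges are the left and right ones; NS if the incoming edges are the upper and lower ones; otherwise NE, SW, NW or SE according as the two outgoing edges are up and right, down and left, up and left, or down and right. $\mathcal{CM}^\delta(2n)$ is the set of all such $CM$. $\mathrm{ns}(CM)$ is the number of elements NS; $\mathrm{ne}_o(CM)$ the number of NE in odd-numbered rows; $\mathrm{se}_e(CM)$ the number of SE in even-numbered rows; $\mathrm{wgt}_e(CM)$ the total number of NE, SE and WE in even-numbered rows. *)

theory Defs
  imports "HOL-Computational_Algebra.Polynomial" "HOL-Library.FuncSet"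
begin

section \<open>Primed shifted tableaux\<close>

datatype letter = Barred nat | Unbarred nat

text \<open>The code realises the order $\overline 1 < 1 < \overline 2 < 2 < \cdots$.\<close>

primrec letter_code :: "letter \<Rightarrow> nat" where
  "letter_code (Barred k) = 2 * k"
| "letter_code (Unbarred k) = 2 * k + 1"

lemma letter_code_inject: "letter_code x = letter_code y \<longleftrightarrow> x = y"
  by (cases x; cases y; simp; presburger)

instantiation letter :: linorder
begin

definition less_eq_letter :: "letter \<Rightarrow> letter \<Rightarrow> bool" where
  "x \<le> y \<longleftrightarrow> letter_code x \<le> letter_code y"

definition less_letter :: "letter \<Rightarrow> letter \<Rightarrow> bool" where
  "x < y \<longleftrightarrow> letter_code x < letter_code y"

instance
  by standard (auto simp: less_eq_letter_def less_letter_def letter_code_inject)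

end

definition letters :: "nat \<Rightarrow> letter set" where
  "letters n = Barred ` {1..n} \<union> Unbarred ` {1..n}"

type_synonym box = "nat \<times> nat"

definition SF :: "nat \<Rightarrow> box set" where
  "SF n = {(i, j). 1 \<le> i \<and> i \<le> j \<and> j \<le> n}"

text \<open>Fillings are extensional functions (undefined outside the shape), so that each tableau
  is counted exactly once.\<close>

definition ST_set :: "nat \<Rightarrow> (box \<Rightarrow> letter) set" where
  "ST_set n = {T \<in> SF n \<rightarrow>\<^sub>E letters n.
     (\<forall>i. (i, i) \<in> SF n \<longrightarrow> T (i, i) \<in> {Unbarred i, Barred i}) \<and>
     (\<forall>i j. (i, j) \<in> SF n \<and> (i, j + 1) \<in> SF n \<longrightarrow> T (i, j) \<le> T (i, j + 1)) \<and>
     (\<forall>i j. (i, j) \<in> SF n \<and> (i + 1, j) \<in> SF n \<longrightarrow> T (i, j) \<le> T (i + 1, j)) \<and>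
     (\<forall>i j. (i, j) \<in> SF n \<and> (i + 1, j + 1) \<in> SF n \<longrightarrow> T (i, j) < T (i + 1, j + 1))}"

definition boxes :: "nat \<Rightarrow> (box \<Rightarrow> letter) \<Rightarrow> letter \<Rightarrow> box set" where
  "boxes n T c = {b \<in> SF n. T b = c}"

definition edge_adjacent :: "box \<Rightarrow> box \<Rightarrow> bool" where
  "edge_adjacent b b' \<longleftrightarrow>
     (fst b = fst b' \<and> (snd b' = snd b + 1 \<or> snd b = snd b' + 1)) \<or>
     (snd b = snd b' \<and> (fst b' = fst b + 1 \<or> fst b = fst b' + 1))"

definition adj_in :: "box set \<Rightarrow> (box \<times> box) set" where
  "adj_in B = {(b, b'). b \<in> B \<and> b' \<in> B \<and> edge_adjacent b b'}"

definition components :: "box set \<Rightarrow> box set set" where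
  "components B = B // (adj_in B)\<^sup>*"

definition con :: "nat \<Rightarrow> letter \<Rightarrow> (box \<Rightarrow> letter) \<Rightarrow> nat" where
  "con n c T = card (components (boxes n T c))"

definition str_ST :: "nat \<Rightarrow> (box \<Rightarrow> letter) \<Rightarrow> nat" where
  "str_ST n T = (\<Sum>c\<in>letters n. con n c T)"

definition bar_ST :: "nat \<Rightarrow> (box \<Rightarrow> letter) \<Rightarrow> nat" where
  "bar_ST n T = card {b \<in> SF n. \<exists>k. T b = Barred k}"

definition row_ST :: "nat \<Rightarrow> nat \<Rightarrow> (box \<Rightarrow> letter) \<Rightarrow> nat" where
  "row_ST n k T = card {i. \<exists>j. (i, j) \<in> SF n \<and> T (i, j) = Unbarred k}"

definition col_ST :: "nat \<Rightarrow> nat \<Rightarrow> (box \<Rightarrow> letter) \<Rightarrow> nat" where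
  "col_ST n k T = card {j. \<exists>i. (i, j) \<in> SF n \<and> T (i, j) = Barred k}"

text \<open>The subtractions on natural numbers never truncate on tableaux: see the lemmas
  \<open>con_le_row_ST\<close> and \<open>con_le_col_ST\<close>, and similarly \<open>n_le_str_ST\<close> for the exponent
  \<open>str_ST n T - n\<close>.\<close>

definition var_ST :: "nat \<Rightarrow> (box \<Rightarrow> letter) \<Rightarrow> nat" where
  "var_ST n T = (\<Sum>k=1..n.
     (row_ST n k T - con n (Unbarred k) T) + (col_ST n k T - con n (Barred k) T))"

lemma finite_SF: "finite (SF n)"
  by (rule finite_subset[of _ "{1..n} \<times> {1..n}"]) (auto simp: SF_def)

lemma finite_boxes: "finite (boxes n T c)"
  using finite_SF by (simp add: boxes_def)

lemma sym_adj_star: "sym ((adj_in B)\<^sup>*)"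
  by (rule sym_rtrancl) (auto simp: sym_def adj_in_def edge_adjacent_def)

lemma class_eq:
  assumes "(x, y) \<in> (adj_in B)\<^sup>*"
  shows "(adj_in B)\<^sup>* `` {x} = (adj_in B)\<^sup>* `` {y}"
  using assms sym_adj_star[of B] by (auto dest: symD intro: rtrancl_trans)

text \<open>If boxes of equal index (row or column number) are connected, then there are at most as
  many components as indices.\<close>

lemma card_components_le:
  fixes f :: "box \<Rightarrow> nat"
  assumes "finite B" and "\<And>x y. x \<in> B \<Longrightarrow> y \<in> B \<Longrightarrow> f x = f y \<Longrightarrow> (x, y) \<in> (adj_in B)\<^sup>*"
  shows "card (components B) \<le> card (f ` B)"
proof -
  define g where "g i = (adj_in B)\<^sup>* `` {SOME x. x \<in> B \<and> f x = i}" for i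
  have "components B \<subseteq> g ` f ` B"
  proof
    fix C assume "C \<in> components B"
    then obtain x where x: "x \<in> B" "C = (adj_in B)\<^sup>* `` {x}"
      by (auto simp: components_def quotient_def)
    let ?y = "SOME y. y \<in> B \<and> f y = f x"
    have "?y \<in> B \<and> f ?y = f x"
      by (rule someI[of _ x]) (use x in auto)
    then have "C = g (f x)"
      unfolding g_def x(2) using class_eq assms(2) x(1) by metis
    then show "C \<in> g ` f ` B" using x(1) by blast
  qed
  then have "card (components B) \<le> card (g ` f ` B)"
    using assms(1) by (intro card_mono) auto
  also have "\<dots> \<le> card (f ` B)"
    using assms(1) by (intro card_image_le) auto
  finally show ?thesis .
qed

lemma ST_row_mono:
  assumes "T \<in> ST_set n" "(i, a) \<in> SF n" "a \<le> b" "b \<le> n"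
  shows "T (i, a) \<le> T (i, b)"
  using assms(3,4)
proof (induction b rule: dec_induct)
  case (step m)
  have "(i, m) \<in> SF n" "(i, m + 1) \<in> SF n"
    using assms(2) step by (auto simp: SF_def)
  then have "T (i, m) \<le> T (i, m + 1)"
    using assms(1) unfolding ST_set_def by blast
  then show ?case using step by (simp add: order_trans)
qed simp

lemma ST_col_mono:
  assumes "T \<in> ST_set n" "1 \<le> a" "a \<le> b" "(b, j) \<in> SF n"
  shows "T (a, j) \<le> T (b, j)"
  using assms(3,4)
proof (induction b rule: dec_induct)
  case (step m)
  have "(m, j) \<in> SF n" "(m + 1, j) \<in> SF n"
    using assms(2) step by (auto simp: SF_def)
  then have "T (m, j) \<le> T (m + 1, j)"
    using assms(1) unfolding ST_set_def by blast
  then show ?case using step \<open>(m, j) \<in> SF n\<close> by (simp add: order_trans)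
qed simp

lemma boxes_row_connected:
  assumes T: "T \<in> ST_set n" and "(i, a) \<in> boxes n T c" "(i, b) \<in> boxes n T c" "a \<le> b"
  shows "((i, a), (i, b)) \<in> (adj_in (boxes n T c))\<^sup>*"
  using assms(4,3)
proof (induction b rule: dec_induct)
  case (step m)
  have SF: "(i, a) \<in> SF n" "(i, m) \<in> SF n" "(i, Suc m) \<in> SF n" "T (i, a) = c" "T (i, Suc m) = c"
    using assms(2) step by (auto simp: SF_def boxes_def)
  have "T (i, a) \<le> T (i, m)" "T (i, m) \<le> T (i, Suc m)"
    using ST_row_mono[OF T SF(1), of m] ST_row_mono[OF T SF(2), of "Suc m"] SF step
    by (auto simp: SF_def)
  then have m: "(i, m) \<in> boxes n T c"
    using SF by (auto simp: boxes_def)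
  then have "((i, m), (i, Suc m)) \<in> adj_in (boxes n T c)"
    using step by (auto simp: adj_in_def edge_adjacent_def)
  then show ?case using step.IH[OF m] by (rule rtrancl_into_rtrancl[rotated])
qed simp

lemma boxes_col_connected:
  assumes T: "T \<in> ST_set n" and "(a, j) \<in> boxes n T c" "(b, j) \<in> boxes n T c" "a \<le> b"
  shows "((a, j), (b, j)) \<in> (adj_in (boxes n T c))\<^sup>*"
  using assms(4,3)
proof (induction b rule: dec_induct)
  case (step m)
  have SF: "(a, j) \<in> SF n" "(m, j) \<in> SF n" "(Suc m, j) \<in> SF n" "T (a, j) = c" "T (Suc m, j) = c"
    using assms(2) step by (auto simp: SF_def boxes_def)
  have "T (a, j) \<le> T (m, j)" "T (m, j) \<le> T (Suc m, j)"
    using ST_col_mono[OF T _ _ SF(2), of a] ST_col_mono[OF T _ _ SF(3), of m] SF step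
    by (auto simp: SF_def)
  then have m: "(m, j) \<in> boxes n T c"
    using SF by (auto simp: boxes_def)
  then have "((m, j), (Suc m, j)) \<in> adj_in (boxes n T c)"
    using step by (auto simp: adj_in_def edge_adjacent_def)
  then show ?case using step.IH[OF m] by (rule rtrancl_into_rtrancl[rotated])
qed simp

lemma con_le_row_ST:
  assumes "T \<in> ST_set n"
  shows "con n (Unbarred k) T \<le> row_ST n k T"
proof -
  let ?B = "boxes n T (Unbarred k)"
  have "card (components ?B) \<le> card (fst ` ?B)"
  proof (rule card_components_le[OF finite_boxes])
    fix x y assume "x \<in> ?B" "y \<in> ?B" "fst x = fst y"
    then show "(x, y) \<in> (adj_in ?B)\<^sup>*"
      using boxes_row_connected[OF assms] sym_adj_star[of ?B]
      by (metis linear prod.collapse symD)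
  qed
  also have "fst ` ?B = {i. \<exists>j. (i, j) \<in> SF n \<and> T (i, j) = Unbarred k}"
    by (force simp: boxes_def)
  finally show ?thesis by (simp add: con_def row_ST_def)
qed

lemma con_le_col_ST:
  assumes "T \<in> ST_set n"
  shows "con n (Barred k) T \<le> col_ST n k T"
proof -
  let ?B = "boxes n T (Barred k)"
  have "card (components ?B) \<le> card (snd ` ?B)"
  proof (rule card_components_le[OF finite_boxes])
    fix x y assume "x \<in> ?B" "y \<in> ?B" "snd x = snd y"
    then show "(x, y) \<in> (adj_in ?B)\<^sup>*"
      using boxes_col_connected[OF assms] sym_adj_star[of ?B]
      by (metis linear prod.collapse symD)
  qed
  also have "snd ` ?B = {j. \<exists>i. (i, j) \<in> SF n \<and> T (i, j) = Barred k}"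
    by (force simp: boxes_def)
  finally show ?thesis by (simp add: con_def col_ST_def)
qed

lemma n_le_str_ST:
  assumes "T \<in> ST_set n"
  shows "n \<le> str_ST n T"
proof -
  let ?d = "\<lambda>i. T (i, i)"
  have diag: "?d i \<in> {Unbarred i, Barred i}" "(i, i) \<in> SF n" if "i \<in> {1..n}" for i
  proof -
    show "(i, i) \<in> SF n" using that by (auto simp: SF_def)
    then show "?d i \<in> {Unbarred i, Barred i}"
      using assms unfolding ST_set_def by blast
  qed
  have inj: "inj_on ?d {1..n}"
  proof (rule inj_onI)
    fix i j assume "i \<in> {1..n}" "j \<in> {1..n}" "?d i = ?d j"
    then show "i = j" using diag(1)[of i] diag(1)[of j] by auto
  qed
  have pos: "1 \<le> con n (?d i) T" if "i \<in> {1..n}" for i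
  proof -
    have "(i, i) \<in> boxes n T (?d i)" using diag(2)[OF that] by (simp add: boxes_def)
    then have "components (boxes n T (?d i)) \<noteq> {}"
      by (auto simp: components_def quotient_def)
    moreover have "finite (components (boxes n T (?d i)))"
      unfolding components_def quotient_def using finite_boxes by blast
    ultimately show ?thesis by (simp add: con_def Suc_le_eq card_gt_0_iff)
  qed
  have "n = (\<Sum>i=1..n. 1)" by simp
  also have "\<dots> \<le> (\<Sum>i=1..n. con n (?d i) T)" by (rule sum_mono) (rule pos)
  also have "\<dots> = (\<Sum>c\<in>?d ` {1..n}. con n c T)" using inj by (simp add: sum.reindex)
  also have "\<dots> \<le> (\<Sum>c\<in>letters n. con n c T)"
  proof (rule sum_mono2)
    show "finite (letters n)" by (simp add: letters_def)
    show "?d ` {1..n} \<subseteq> letters n"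
      using diag(1) unfolding letters_def by blast
  qed simp
  finally show ?thesis by (simp add: str_ST_def)
qed


section \<open>U-turn alternating sign matrices\<close>

text \<open>A $2n \times n$ matrix is an extensional function on its index set of pairs
  (row, column), rows numbered from the top and columns from the left.\<close>

definition positions :: "nat \<Rightarrow> (nat \<times> nat) set" where
  "positions n = {1..2 * n} \<times> {1..n}"

definition UA_set :: "nat \<Rightarrow> (nat \<times> nat \<Rightarrow> int) set" where
  "UA_set n = {A \<in> positions n \<rightarrow>\<^sub>E {-1, 0, 1}.
     (\<forall>i\<in>{1..2 * n}. \<forall>p\<in>{1..n}. (\<Sum>q=p..n. A (i, q)) \<in> {0, 1}) \<and>
     (\<forall>j\<in>{1..2 * n}. \<forall>q\<in>{1..n}. (\<Sum>i=j..2 * n. A (i, q)) \<in> {0, 1}) \<and>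
     (\<forall>i\<in>{1..n}. (\<Sum>q=1..n. A (2 * i - 1, q) + A (2 * i, q)) = 1) \<and>
     (\<forall>q\<in>{1..n}. (\<Sum>i=1..2 * n. A (i, q)) = 1)}"

definition nearest_right :: "nat \<Rightarrow> (nat \<times> nat \<Rightarrow> int) \<Rightarrow> nat \<times> nat \<Rightarrow> int \<Rightarrow> bool" where
  "nearest_right n A = (\<lambda>(i, q) x. x \<noteq> 0 \<and>
     (\<exists>r. q < r \<and> r \<le> n \<and> A (i, r) = x \<and> (\<forall>s. q < s \<and> s < r \<longrightarrow> A (i, s) = 0)))"

definition nearest_below :: "nat \<Rightarrow> (nat \<times> nat \<Rightarrow> int) \<Rightarrow> nat \<times> nat \<Rightarrow> int \<Rightarrow> bool" where
  "nearest_below n A = (\<lambda>(i, q) x. x \<noteq> 0 \<and>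
     (\<exists>r. i < r \<and> r \<le> 2 * n \<and> A (r, q) = x \<and> (\<forall>s. i < s \<and> s < r \<longrightarrow> A (s, q) = 0)))"

definition positive_zero :: "nat \<Rightarrow> (nat \<times> nat \<Rightarrow> int) \<Rightarrow> nat \<times> nat \<Rightarrow> bool" where
  "positive_zero n A p \<longleftrightarrow> A p = 0 \<and> nearest_right n A p 1"

definition neg_UA :: "nat \<Rightarrow> (nat \<times> nat \<Rightarrow> int) \<Rightarrow> nat" where
  "neg_UA n A = card {p \<in> positions n. A p = -1}"

definition bar_UA :: "nat \<Rightarrow> (nat \<times> nat \<Rightarrow> int) \<Rightarrow> nat" where
  "bar_UA n A = card {p \<in> positions n. even (fst p) \<and> (A p = 1 \<or> positive_zero n A p)}"

definition ssi_UA :: "nat \<Rightarrow> (nat \<times> nat \<Rightarrow> int) \<Rightarrow> nat" where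
  "ssi_UA n A = card {p \<in> positions n. positive_zero n A p \<and>
     ((odd (fst p) \<and> nearest_below n A p 1) \<or>
      (even (fst p) \<and> (nearest_below n A p (-1) \<or> \<not> (\<exists>x. nearest_below n A p x))))}"


section \<open>Square ice configuration matrices\<close>

text \<open>An orientation of the grid is given by two functions:
  \<open>h (i, q)\<close> (for \<open>1 \<le> i \<le> 2n\<close>, \<open>0 \<le> q \<le> n\<close>) holds iff the horizontal edge joining columns
  \<open>q\<close> and \<open>q + 1\<close> in row \<open>i\<close> points right; \<open>v (i, q)\<close> (for \<open>0 \<le> i \<le> 2n\<close>, \<open>1 \<le> q \<le> n\<close>) holds
  iff the vertical edge joining rows \<open>i\<close> and \<open>i + 1\<close> in column \<open>q\<close> points down.  The indices
  \<open>q = 0, n\<close> and \<open>i = 0, 2n\<close> give the boundary edges.\<close>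

type_synonym edges = "nat \<times> nat \<Rightarrow> bool"

datatype side = Up | Down | Left | Right

fun incoming :: "edges \<Rightarrow> edges \<Rightarrow> nat \<times> nat \<Rightarrow> side \<Rightarrow> bool" where
  "incoming h v (i, q) Up \<longleftrightarrow> v (i - 1, q)"
| "incoming h v (i, q) Down \<longleftrightarrow> \<not> v (i, q)"
| "incoming h v (i, q) Left \<longleftrightarrow> h (i, q - 1)"
| "incoming h v (i, q) Right \<longleftrightarrow> \<not> h (i, q)"

definition ins :: "edges \<Rightarrow> edges \<Rightarrow> nat \<times> nat \<Rightarrow> side set" where
  "ins h v p = {d. incoming h v p d}"

definition outs :: "edges \<Rightarrow> edges \<Rightarrow> nat \<times> nat \<Rightarrow> side set" where
  "outs h v p = {d. \<not> incoming h v p d}"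

definition square_ice :: "nat \<Rightarrow> edges \<Rightarrow> edges \<Rightarrow> bool" where
  "square_ice n h v \<longleftrightarrow>
     (\<forall>p\<in>positions n. card (ins h v p) = 2 \<and> card (outs h v p) = 2) \<and>
     (\<forall>i\<in>{1..2 * n}. incoming h v (i, n) Right) \<and>
     (\<forall>q\<in>{1..n}. \<not> incoming h v (2 * n, q) Down) \<and>
     (\<forall>q\<in>{1..n}. \<not> incoming h v (1, q) Up) \<and>
     (\<forall>i\<in>{1..n}. incoming h v (2 * i - 1, 1) Left \<longleftrightarrow> \<not> incoming h v (2 * i, 1) Left)"

datatype ice = WE | NS | NE | SW | NW | SE

definition ice_element :: "edges \<Rightarrow> edges \<Rightarrow> nat \<times> nat \<Rightarrow> ice" where
  "ice_element h v p =
     (if ins h v p = {Left, Right} then WE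
      else if ins h v p = {Up, Down} then NS
      else if outs h v p = {Up, Right} then NE
      else if outs h v p = {Down, Left} then SW
      else if outs h v p = {Up, Left} then NW
      else SE)"

definition CM_set :: "nat \<Rightarrow> (nat \<times> nat \<Rightarrow> ice) set" where
  "CM_set n = {restrict (ice_element h v) (positions n) | h v. square_ice n h v}"

definition ns_CM :: "nat \<Rightarrow> (nat \<times> nat \<Rightarrow> ice) \<Rightarrow> nat" where
  "ns_CM n C = card {p \<in> positions n. C p = NS}"

definition ne_o_CM :: "nat \<Rightarrow> (nat \<times> nat \<Rightarrow> ice) \<Rightarrow> nat" where
  "ne_o_CM n C = card {p \<in> positions n. odd (fst p) \<and> C p = NE}"

definition se_e_CM :: "nat \<Rightarrow> (nat \<times> nat \<Rightarrow> ice) \<Rightarrow> nat" where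
  "se_e_CM n C = card {p \<in> positions n. even (fst p) \<and> C p = SE}"

definition wgt_e_CM :: "nat \<Rightarrow> (nat \<times> nat \<Rightarrow> ice) \<Rightarrow> nat" where
  "wgt_e_CM n C = card {p \<in> positions n. even (fst p) \<and> C p \<in> {NE, SE, WE}}"

lemma finite_positions: "finite (positions n)"
  by (simp add: positions_def)

lemma finite_ST_set: "finite (ST_set n)"
  unfolding ST_set_def letters_def
  by (intro finite_subset[OF Collect_restrict] finite_PiE finite_SF) auto

lemma finite_UA_set: "finite (UA_set n)"
  unfolding UA_set_def
  by (intro finite_subset[OF Collect_restrict] finite_PiE finite_positions) auto

lemma finite_CM_set: "finite (CM_set n)"
proof (rule finite_subset)
  have "(UNIV :: ice set) = {WE, NS, NE, SW, NW, SE}"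
    using ice.exhaust by blast
  then have "finite (UNIV :: ice set)"
    by (metis finite.emptyI finite.insertI)
  then show "finite (positions n \<rightarrow>\<^sub>E (UNIV :: ice set))"
    by (intro finite_PiE finite_positions)
  show "CM_set n \<subseteq> positions n \<rightarrow>\<^sub>E UNIV"
    unfolding CM_set_def by fastforce
qed

end

theory Submission
  imports "Jordan_Normal_Form.Determinant" Defs
begin

text \<open>Read a tableau by its diagonals \<open>j - i + 1 = q\<close>: each diagonal is a strictly increasing
  sequence of letters, consecutive diagonals interlace, and both \<open>str\<close> and \<open>var\<close> become local,
  because the components of a letter are ribbons, counted by their south-western ends.  Summing
  over a diagonal that interlaces the previous one turns a determinant \<open>det (f\<^sub>j(y\<^sub>i))\<close> into one
  of the next size: the local weights telescope, so the sum over an interval is a difference of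
  two values of a discrete antiderivative of \<open>f\<^sub>j\<close>, and the differences are the row operations
  that eliminate a column of ones.  After summing over the two possible entries of every box of
  the main diagonal, the functions are polynomials in the row index of degree \<open>j\<close> whose
  coefficient at \<open>(i choose j)\<close> is \<open>(1 + t)\<^bsup>2j+1\<^esup>\<close>, so the determinant is \<open>(1 + t)\<^bsup>n\<^sup>2\<^esup>\<close>.

  For the other two sums, number the letters so that the bottom row \<open>2n\<close> belongs to the
  smallest letter.  The suffix sum of row \<open>i\<close> of the matrix starting at column \<open>q\<close> tells whether
  the letter of row \<open>i\<close> occurs on diagonal \<open>q\<close>; the condition on the column sums is the
  interlacing of the diagonals.  In the ice model the row and column suffix sums are the
  orientations of the horizontal and vertical edges.\<close>

section \<open>Sums of determinants\<close>

lemma det_mat_leibniz: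
  "det (mat k k (\<lambda>(i, j). A i j)) = (\<Sum>p | p permutes {0..<k}. signof p * (\<Prod>i<k. A i (p i)))"
proof -
  have "p i < k" if "p permutes {0..<k}" "i < k" for p i
    using permutes_in_image[OF that(1), of i] that(2) by simp
  then show ?thesis
    by (auto simp: det_def atLeast0LessThan intro!: sum.cong prod.cong arg_cong[where f = "\<lambda>z. _ * z"])
qed

lemma det_row_factors:
  "det (mat k k (\<lambda>(i, j). c i * A i j)) = (\<Prod>i<k. c i) * det (mat k k (\<lambda>(i, j). A i j))"
  for A :: "nat \<Rightarrow> nat \<Rightarrow> 'b :: comm_ring_1"
  by (simp add: det_mat_leibniz prod.distrib sum_distrib_left mult.left_commute)

text \<open>Multilinearity in the rows: row \<open>i\<close> is a combination of vectors indexed by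
  its own set \<open>X i\<close>, so expanding the product in each Leibniz term gives one
  determinant per choice of a point in every row.\<close>

lemma det_row_sums:
  fixes f :: "nat \<Rightarrow> 'a \<Rightarrow> 'b :: comm_ring_1"
  assumes "\<And>i. i < k \<Longrightarrow> finite (X i)"
  shows "det (mat k k (\<lambda>(i, j). \<Sum>y\<in>X i. g i y * f j y))
       = (\<Sum>y\<in>(\<Pi>\<^sub>E i\<in>{..<k}. X i). (\<Prod>i<k. g i (y i)) * det (mat k k (\<lambda>(i, j). f j (y i))))"
proof -
  let ?P = "{p. p permutes {0..<k}}"
  have "det (mat k k (\<lambda>(i, j). \<Sum>y\<in>X i. g i y * f j y))
      = (\<Sum>p\<in>?P. signof p * (\<Prod>i<k. \<Sum>y\<in>X i. g i y * f (p i) y))"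
    by (rule det_mat_leibniz)
  also have "\<dots> = (\<Sum>p\<in>?P. \<Sum>y\<in>(\<Pi>\<^sub>E i\<in>{..<k}. X i).
      (\<Prod>i<k. g i (y i)) * (signof p * (\<Prod>i<k. f (p i) (y i))))"
    using assms by (subst prod_sum_PiE) (auto simp: sum_distrib_left prod.distrib mult_ac)
  also have "\<dots> = (\<Sum>y\<in>(\<Pi>\<^sub>E i\<in>{..<k}. X i). (\<Prod>i<k. g i (y i)) *
      (\<Sum>p\<in>?P. signof p * (\<Prod>i<k. f (p i) (y i))))"
    by (subst sum.swap) (simp add: sum_distrib_left)
  also have "\<dots> = (\<Sum>y\<in>(\<Pi>\<^sub>E i\<in>{..<k}. X i).
      (\<Prod>i<k. g i (y i)) * det (mat k k (\<lambda>(i, j). f j (y i))))"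
    by (simp add: det_mat_leibniz)
  finally show ?thesis .
qed

text \<open>Subtracting from each row its predecessor turns the column of ones into the first unit
  vector, and expansion along that column leaves the differences. The unipotent matrix
  \<open>U\<close> carries out these row operations.\<close>

lemma det_consecutive_differences:
  fixes G :: "nat \<Rightarrow> 'a \<Rightarrow> 'b :: comm_ring_1"
  shows "det (mat (Suc k) (Suc k) (\<lambda>(i, j). case j of 0 \<Rightarrow> 1 | Suc j' \<Rightarrow> G j' (x i)))
       = det (mat k k (\<lambda>(i, j). G j (x (Suc i)) - G j (x i)))"
proof -
  let ?n = "Suc k"
  let ?M = "mat ?n ?n (\<lambda>(i, j). case j of 0 \<Rightarrow> 1 | Suc j' \<Rightarrow> G j' (x i))"
  define U :: "'b mat" where
    "U = mat ?n ?n (\<lambda>(i, j). if j = i then 1 else if Suc j = i then - 1 else 0)"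
  define D where "D = mat ?n ?n (\<lambda>(i, j). ?M $$ (i, j) - (if i = 0 then 0 else ?M $$ (i - 1, j)))"
  have U: "U \<in> carrier_mat ?n ?n" and M: "?M \<in> carrier_mat ?n ?n" and D: "D \<in> carrier_mat ?n ?n"
    by (auto simp: U_def D_def)
  have "U * ?M = D"
  proof (rule eq_matI)
    fix i j assume "i < dim_row D" "j < dim_col D"
    then have ij: "i < ?n" "j < ?n" by (auto simp: D_def)
    have "(U * ?M) $$ (i, j) = (\<Sum>l\<in>{0..<?n}. U $$ (i, l) * ?M $$ (l, j))"
      using ij U M by (simp add: scalar_prod_def)
    also have "\<dots> = (\<Sum>l\<in>{0..<?n}. (if l = i then ?M $$ (l, j) else 0)
        - (if Suc l = i then ?M $$ (l, j) else 0))"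
      using ij by (intro sum.cong) (auto simp: U_def)
    also have "\<dots> = D $$ (i, j)"
      using ij by (cases i) (auto simp: D_def sum_subtractf)
    finally show "(U * ?M) $$ (i, j) = D $$ (i, j)" .
  qed (auto simp: U_def D_def)
  moreover have "det U = 1"
    by (subst det_lower_triangular[OF _ U]) (auto simp: U_def prod_list_diag_prod)
  ultimately have "det ?M = det D"
    using det_mult[OF U M] by simp
  also have "\<dots> = (\<Sum>i<?n. D $$ (i, 0) * cofactor D i 0)"
    by (rule laplace_expansion_column[OF D]) simp
  also have "\<dots> = (\<Sum>i<?n. if i = 0 then cofactor D 0 0 else 0)"
    by (intro sum.cong) (auto simp: D_def)
  also have "\<dots> = det (mat_delete D 0 0)"
    by (simp add: cofactor_def)
  also have "mat_delete D 0 0 = mat k k (\<lambda>(i, j). G j (x (Suc i)) - G j (x i))"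
    by (rule eq_matI) (auto simp: mat_delete_def D_def)
  finally show ?thesis .
qed

section \<open>Summation over interlacing diagonals\<close>

lemma mem_SF [simp]: "(i, j) \<in> SF n \<longleftrightarrow> 1 \<le> i \<and> i \<le> j \<and> j \<le> n"
  by (simp add: SF_def)

text \<open>\<open>lower_wt\<close> does double duty: it is the factor of a letter for
  \<open>bar_ST\<close>, and also its factor for \<open>var_ST\<close> when the box repeats its left
  neighbour. \<open>upper_wt\<close> is the factor for \<open>var_ST\<close> when the box repeats
  the letter below it.\<close>

primrec lower_wt :: "'b \<Rightarrow> letter \<Rightarrow> 'b :: comm_ring_1" where
  "lower_wt t (Barred k) = t"
| "lower_wt t (Unbarred k) = 1"

primrec upper_wt :: "'b \<Rightarrow> letter \<Rightarrow> 'b :: comm_ring_1" where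
  "upper_wt t (Barred k) = 1"
| "upper_wt t (Unbarred k) = t"

lemma lower_wt_plus_upper_wt: "lower_wt t c + upper_wt t c = 1 + t"
  by (cases c) auto

text \<open>Here \<open>a\<close> is the left neighbour of \<open>y\<close> and \<open>b\<close> the
  letter below it. A box equal to neither is the south-western end of a ribbon and contributes one
  to \<open>str_ST\<close>, hence \<open>1 + t\<close>. Strictness along diagonals gives
  \<open>a < b\<close>, so the two equality cases exclude each other.\<close>

definition interlace_wt :: "'b \<Rightarrow> letter \<Rightarrow> letter \<Rightarrow> letter \<Rightarrow> 'b :: comm_ring_1" where
  "interlace_wt t a y b = (if y = a then lower_wt t a else if y = b then upper_wt t b else 1 + t)"

text \<open>A main diagonal box always ends a ribbon; giving it the factor 1 in place of
  \<open>1 + t\<close> accounts for the \<open>- n\<close> in the exponent.\<close>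

definition box_wt :: "'b \<Rightarrow> (box \<Rightarrow> letter) \<Rightarrow> box \<Rightarrow> 'b :: comm_ring_1" where
  "box_wt t T = (\<lambda>(i, j). lower_wt t (T (i, j)) *
     (if i < j then interlace_wt t (T (i, j - 1)) (T (i, j)) (T (Suc i, j)) else 1))"

text \<open>The shape has size \<open>k\<close> while the alphabet stays that of \<open>n\<close>,
  and the main diagonal is free: the induction on \<open>k\<close> passes through smaller shapes
  whose main diagonal is a superdiagonal of the final tableau.\<close>

definition arrays :: "nat \<Rightarrow> nat \<Rightarrow> (box \<Rightarrow> letter) set" where
  "arrays n k = {T \<in> SF k \<rightarrow>\<^sub>E letters n.
     (\<forall>i j. 1 \<le> i \<and> i \<le> j \<and> j < k \<longrightarrow> T (i, j) \<le> T (i, Suc j)) \<and>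
     (\<forall>i j. 1 \<le> i \<and> i < j \<and> j \<le> k \<longrightarrow> T (i, j) \<le> T (Suc i, j)) \<and>
     (\<forall>i j. 1 \<le> i \<and> i \<le> j \<and> j < k \<longrightarrow> T (i, j) < T (Suc i, Suc j))}"

text \<open>Passing to the next longer diagonal applies the antiderivative belonging to
  \<open>interlace_wt\<close> and then multiplies by the factor \<open>lower_wt\<close> of the new
  box. Level \<open>j\<close> is the result of \<open>j\<close> such rounds, starting from the
  weight of a single box.\<close>

primrec ladder :: "nat \<Rightarrow> 'b \<Rightarrow> nat \<Rightarrow> letter \<Rightarrow> 'b :: comm_ring_1" where
  "ladder n t 0 = lower_wt t"
| "ladder n t (Suc j) = (\<lambda>c. lower_wt t c *
     ((1 + t) * (\<Sum>y | y \<in> letters n \<and> y < c. ladder n t j y) + upper_wt t c * ladder n t j c))"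

lemma finite_letters: "finite (letters n)"
  by (simp add: letters_def)

lemma finite_arrays: "finite (arrays n k)"
  unfolding arrays_def
  by (intro finite_subset[OF Collect_restrict] finite_PiE finite_SF finite_letters)

text \<open>The interlacing weights telescope because the weights of the two ends of an interval
  add up to the weight \<open>1 + t\<close> of an interior point.\<close>

lemma sum_interlace_wt:
  fixes f :: "letter \<Rightarrow> 'b :: comm_ring_1" and t :: 'b
  assumes "a \<in> letters n" "b \<in> letters n" "a < b"
  defines "G \<equiv> \<lambda>c. (1 + t) * (\<Sum>y | y \<in> letters n \<and> y < c. f y) + upper_wt t c * f c"
  shows "(\<Sum>y\<in>letters n \<inter> {a..b}. interlace_wt t a y b * f y) = G b - G a"
proof -
  let ?M = "letters n \<inter> {a<..<b}" and ?A = "{y. y \<in> letters n \<and> y < a}"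
  have fin: "finite ?M" "finite ?A"
    using finite_letters by auto
  have 1: "letters n \<inter> {a..b} = insert a (insert b ?M)" 
    and 2: "{y. y \<in> letters n \<and> y < b} = insert a (?A \<union> ?M)"
    using assms by auto
  have "(\<Sum>y\<in>letters n \<inter> {a..b}. interlace_wt t a y b * f y)
      = lower_wt t a * f a + upper_wt t b * f b + (\<Sum>y\<in>?M. interlace_wt t a y b * f y)"
    unfolding 1 using fin less_imp_neq[OF assms(3)] by (auto simp: interlace_wt_def add.assoc)
  also have "(\<Sum>y\<in>?M. interlace_wt t a y b * f y) = (1 + t) * (\<Sum>y\<in>?M. f y)"
    by (auto simp: interlace_wt_def sum_distrib_left intro!: sum.cong)
  finally have L: "(\<Sum>y\<in>letters n \<inter> {a..b}. interlace_wt t a y b * f y)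
      = lower_wt t a * f a + upper_wt t b * f b + (1 + t) * (\<Sum>y\<in>?M. f y)" .
  have disj: "?A \<inter> ?M = {}"
    by (auto dest: order.asym)
  have "(\<Sum>y | y \<in> letters n \<and> y < b. f y) = f a + (sum f ?A + sum f ?M)"
    unfolding 2 using fin assms(3) disj by (subst sum.insert) (auto simp: sum.union_disjoint)
  then have R: "G b = (1 + t) * (f a + (sum f ?A + sum f ?M)) + upper_wt t b * f b"
    by (simp add: G_def)
  have lower: "lower_wt t a = 1 + t - upper_wt t a"
    by (simp only: eq_diff_eq lower_wt_plus_upper_wt)
  show ?thesis
    unfolding L R lower by (simp add: G_def algebra_simps)
qed

text \<open>The independent sums over the \<open>y i\<close> move into the rows, where each entry
  telescopes to a difference of values of \<open>G\<close>. Restoring the column of ones and scaling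
  row \<open>i\<close> by \<open>lower_wt t (x i)\<close> produces exactly the columns
  \<open>ladder n t j\<close>, one size larger.\<close>

lemma sum_interlacing_det:
  fixes t :: "'b :: comm_ring_1"
  assumes "\<And>i. i < Suc k \<Longrightarrow> x i \<in> letters n" "\<And>i. i < k \<Longrightarrow> x i < x (Suc i)"
  shows "(\<Prod>i<Suc k. lower_wt t (x i)) *
      (\<Sum>y\<in>(\<Pi>\<^sub>E i\<in>{..<k}. letters n \<inter> {x i..x (Suc i)}).
        (\<Prod>i<k. interlace_wt t (x i) (y i) (x (Suc i))) * det (mat k k (\<lambda>(i, j). ladder n t j (y i))))
    = det (mat (Suc k) (Suc k) (\<lambda>(i, j). ladder n t j (x i)))"
proof -
  define G where "G j c = (1 + t) * (\<Sum>y | y \<in> letters n \<and> y < c. ladder n t j y)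
    + upper_wt t c * ladder n t j c" for j c
  have "(\<Sum>y\<in>(\<Pi>\<^sub>E i\<in>{..<k}. letters n \<inter> {x i..x (Suc i)}).
        (\<Prod>i<k. interlace_wt t (x i) (y i) (x (Suc i))) * det (mat k k (\<lambda>(i, j). ladder n t j (y i))))
      = det (mat k k (\<lambda>(i, j). \<Sum>y\<in>letters n \<inter> {x i..x (Suc i)}.
          interlace_wt t (x i) y (x (Suc i)) * ladder n t j y))"
    by (rule det_row_sums[symmetric]) (use finite_letters in auto)
  also have "\<dots> = det (mat k k (\<lambda>(i, j). G j (x (Suc i)) - G j (x i)))"
    using assms by (intro arg_cong[where f = det] cong_mat) (auto simp: sum_interlace_wt G_def)
  also have "\<dots> = det (mat (Suc k) (Suc k) (\<lambda>(i, j). case j of 0 \<Rightarrow> 1 | Suc j' \<Rightarrow> G j' (x i)))"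
    by (rule det_consecutive_differences[symmetric])
  finally have "(\<Prod>i<Suc k. lower_wt t (x i)) *
      (\<Sum>y\<in>(\<Pi>\<^sub>E i\<in>{..<k}. letters n \<inter> {x i..x (Suc i)}).
        (\<Prod>i<k. interlace_wt t (x i) (y i) (x (Suc i))) * det (mat k k (\<lambda>(i, j). ladder n t j (y i))))
    = (\<Prod>i<Suc k. lower_wt t (x i)) *
      det (mat (Suc k) (Suc k) (\<lambda>(i, j). case j of 0 \<Rightarrow> 1 | Suc j' \<Rightarrow> G j' (x i)))"
    by simp
  also have "\<dots> = det (mat (Suc k) (Suc k)
      (\<lambda>(i, j). lower_wt t (x i) * (case j of 0 \<Rightarrow> 1 | Suc j' \<Rightarrow> G j' (x i))))"
    by (rule det_row_factors[symmetric])
  also have "\<dots> = det (mat (Suc k) (Suc k) (\<lambda>(i, j). ladder n t j (x i)))"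
    by (intro arg_cong[where f = det] cong_mat) (auto simp: G_def split: nat.split)
  finally show ?thesis .
qed

section \<open>Adjoining and removing a main diagonal\<close>

definition add_diagonal :: "nat \<Rightarrow> (nat \<Rightarrow> letter) \<Rightarrow> (box \<Rightarrow> letter) \<Rightarrow> box \<Rightarrow> letter" where
  "add_diagonal k x T = restrict (\<lambda>(i, j). if i = j then x (i - 1) else T (i, j - 1)) (SF (Suc k))"

definition drop_diagonal :: "nat \<Rightarrow> (box \<Rightarrow> letter) \<Rightarrow> box \<Rightarrow> letter" where
  "drop_diagonal k T = restrict (\<lambda>(i, j). T (i, Suc j)) (SF k)"

lemma add_diagonal_in_arrays:
  assumes T: "T \<in> arrays n k" and x: "\<And>i. i < Suc k \<Longrightarrow> x i \<in> letters n" "\<And>i. i < k \<Longrightarrow> x i < x (Suc i)"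
    and inter: "\<And>i. i < k \<Longrightarrow> x i \<le> T (Suc i, Suc i) \<and> T (Suc i, Suc i) \<le> x (Suc i)"
  shows "add_diagonal k x T \<in> arrays n (Suc k)"
proof -
  let ?T = "add_diagonal k x T"
  have val: "?T (i, j) = (if i = j then x (i - 1) else T (i, j - 1))" if "1 \<le> i" "i \<le> j" "j \<le> Suc k" for i j
    using that by (simp add: add_diagonal_def)
  have L: "T (i, j) \<in> letters n" if "1 \<le> i" "i \<le> j" "j \<le> k" for i j
    using T that by (auto simp: arrays_def)
  have R: "T (i, j) \<le> T (i, Suc j)" "T (i, j) < T (Suc i, Suc j)" if "1 \<le> i" "i \<le> j" "j < k" for i j
    using T that by (auto simp: arrays_def)
  have C: "T (i, j) \<le> T (Suc i, j)" if "1 \<le> i" "i < j" "j \<le> k" for i j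
    using T that by (auto simp: arrays_def)
  have "?T (i, j) \<in> letters n" if "1 \<le> i" "i \<le> j" "j \<le> Suc k" for i j
    using that L[of i "j - 1"] x(1)[of "i - 1"] by (auto simp: val)
  moreover have "?T (i, j) \<le> ?T (i, Suc j)" if "1 \<le> i" "i \<le> j" "j < Suc k" for i j
    using that R(1)[of i "j - 1"] inter[of "i - 1"] by (auto simp: val)
  moreover have "?T (i, j) \<le> ?T (Suc i, j)" if "1 \<le> i" "i < j" "j \<le> Suc k" for i j
    using that C[of i "j - 1"] inter[of "i - 1"] by (auto simp: val)
  moreover have "?T (i, j) < ?T (Suc i, Suc j)" if "1 \<le> i" "i \<le> j" "j < Suc k" for i j
    using that R(2)[of i "j - 1"] x(2)[of "i - 1"] by (auto simp: val)
  moreover have "?T \<in> extensional (SF (Suc k))"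
    by (simp add: add_diagonal_def)
  ultimately show ?thesis
    by (auto simp: arrays_def PiE_def)
qed

lemma drop_diagonal_in_arrays:
  assumes "T \<in> arrays n (Suc k)"
  shows "drop_diagonal k T \<in> arrays n k"
  using assms by (auto simp: arrays_def drop_diagonal_def PiE_def)

lemma add_drop_diagonal:
  assumes "T \<in> arrays n (Suc k)" "\<And>i. i < Suc k \<Longrightarrow> T (Suc i, Suc i) = x i"
  shows "add_diagonal k x (drop_diagonal k T) = T"
proof
  fix b
  show "add_diagonal k x (drop_diagonal k T) b = T b"
  proof (cases "b \<in> SF (Suc k)")
    case True
    then obtain i j where b: "b = (i, j)" "1 \<le> i" "i \<le> j" "j \<le> Suc k"
      by (cases b) auto
    then show ?thesis
      using assms(2)[of "i - 1"] by (auto simp: add_diagonal_def drop_diagonal_def)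
  next
    case False
    then show ?thesis
      using assms(1) by (cases b) (auto simp: add_diagonal_def arrays_def PiE_def extensional_def)
  qed
qed

lemma drop_add_diagonal:
  assumes "T \<in> arrays n k"
  shows "drop_diagonal k (add_diagonal k x T) = T"
proof
  fix b
  show "drop_diagonal k (add_diagonal k x T) b = T b"
  proof (cases "b \<in> SF k")
    case True
    then show ?thesis
      by (cases b) (auto simp: add_diagonal_def drop_diagonal_def)
  next
    case False
    then show ?thesis
      using assms by (cases b) (auto simp: drop_diagonal_def arrays_def PiE_def extensional_def)
  qed
qed

lemma prod_SF_Suc:
  fixes h :: "box \<Rightarrow> 'b :: comm_monoid_mult"
  shows "(\<Prod>b\<in>SF (Suc k). h b) = (\<Prod>i<Suc k. h (Suc i, Suc i)) * (\<Prod>(i, j)\<in>SF k. h (i, Suc j))"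
proof -
  let ?d = "\<lambda>i::nat. (Suc i, Suc i)" and ?s = "\<lambda>(i::nat, j). (i, Suc j)"
  have "SF (Suc k) = ?d ` {..<Suc k} \<union> ?s ` SF k"
  proof (intro equalityI subsetI)
    fix b assume "b \<in> SF (Suc k)"
    then obtain i j where b: "b = (i, j)" "1 \<le> i" "i \<le> j" "j \<le> Suc k"
      by (cases b) auto
    show "b \<in> ?d ` {..<Suc k} \<union> ?s ` SF k"
    proof (cases "i = j")
      case True
      then have "b = ?d (i - 1)" "i - 1 \<in> {..<Suc k}" using b by auto
      then show ?thesis by blast
    next
      case False
      then have "b = ?s (i, j - 1)" "(i, j - 1) \<in> SF k" using b by auto
      then show ?thesis by blast
    qed
  qed auto
  moreover have "?d ` {..<Suc k} \<inter> ?s ` SF k = {}" by auto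
  moreover have "inj_on ?d {..<Suc k}" "inj_on ?s (SF k)" by (auto simp: inj_on_def)
  ultimately show ?thesis
    using finite_SF[of k]
    by (simp add: prod.union_disjoint prod.reindex case_prod_unfold)
qed

lemma prod_SF_diagonal:
  fixes h :: "nat \<Rightarrow> 'b :: comm_monoid_mult"
  shows "(\<Prod>(i, j)\<in>SF k. if i = j then h i else 1) = (\<Prod>i<k. h (Suc i))"
proof -
  have "(\<Prod>(i, j)\<in>SF k. if i = j then h i else 1) = (\<Prod>(i, j)\<in>(\<lambda>i. (Suc i, Suc i)) ` {..<k}. h i)"
  proof (rule prod.mono_neutral_cong_right[OF finite_SF])
    show "\<forall>b\<in>SF k - (\<lambda>i. (Suc i, Suc i)) ` {..<k}. (case b of (i, j) \<Rightarrow> if i = j then h i else 1) = 1"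
    proof safe
      fix i j assume b: "(i, j) \<in> SF k" "(i, j) \<notin> (\<lambda>i. (Suc i, Suc i)) ` {..<k}"
      have "i \<noteq> j"
      proof
        assume "i = j"
        then have "(i, j) = (\<lambda>i. (Suc i, Suc i)) (i - 1)" "i - 1 \<in> {..<k}" using b(1) by auto
        then show False using b(2) by blast
      qed
      then show "(if i = j then h i else 1) = 1" by simp
    qed
  qed auto
  also have "\<dots> = (\<Prod>i<k. h (Suc i))"
    by (subst prod.reindex) (auto simp: inj_on_def)
  finally show ?thesis .
qed

text \<open>The old boxes move one column to the right, so the old main diagonal becomes the first
  superdiagonal and acquires an \<open>interlace_wt\<close> factor from its new neighbours in
  \<open>x\<close>. All other weights depend only on relative positions and are unchanged.\<close>

lemma box_wt_add_diagonal:
  fixes t :: "'b :: comm_ring_1"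
  shows "(\<Prod>b\<in>SF (Suc k). box_wt t (add_diagonal k x T) b)
    = (\<Prod>i<Suc k. lower_wt t (x i)) *
      ((\<Prod>i<k. interlace_wt t (x i) (T (Suc i, Suc i)) (x (Suc i))) * (\<Prod>b\<in>SF k. box_wt t T b))"
proof -
  let ?T = "add_diagonal k x T"
  have "(\<Prod>(i, j)\<in>SF k. box_wt t ?T (i, Suc j))
      = (\<Prod>(i, j)\<in>SF k. (if i = j then interlace_wt t (x (i - 1)) (T (i, i)) (x i) else 1) * box_wt t T (i, j))"
    by (intro prod.cong) (auto simp: box_wt_def add_diagonal_def mult_ac)
  also have "\<dots> = (\<Prod>(i, j)\<in>SF k. if i = j then interlace_wt t (x (i - 1)) (T (i, i)) (x i) else 1)
      * (\<Prod>b\<in>SF k. box_wt t T b)"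
    by (simp add: case_prod_unfold prod.distrib)
  finally show ?thesis
    by (simp add: prod_SF_Suc prod_SF_diagonal box_wt_def add_diagonal_def del: prod.lessThan_Suc)
qed

text \<open>Induction on the size with the main diagonal \<open>x\<close> prescribed. Deleting it
  leaves an array whose main diagonal interlaces \<open>x\<close>. Grouping these arrays by that
  diagonal \<open>y\<close>, the induction hypothesis turns each group into a determinant, and
  \<open>sum_interlacing_det\<close> sums over \<open>y\<close>.\<close>

lemma sum_arrays_diagonal:
  fixes t :: "'b :: comm_ring_1"
  assumes "\<And>i. i < k \<Longrightarrow> x i \<in> letters n" "\<And>i. Suc i < k \<Longrightarrow> x i < x (Suc i)"
  shows "(\<Sum>T | T \<in> arrays n k \<and> (\<forall>i<k. T (Suc i, Suc i) = x i). \<Prod>b\<in>SF k. box_wt t T b)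
    = det (mat k k (\<lambda>(i, j). ladder n t j (x i)))"
  using assms
proof (induction k arbitrary: x)
  case 0
  have "SF 0 = {}" by (auto simp: SF_def)
  then have "{T. T \<in> arrays n 0 \<and> (\<forall>i<0. T (Suc i, Suc i) = x i)} = {\<lambda>_. undefined}"
    by (auto simp: arrays_def)
  then show ?case using \<open>SF 0 = {}\<close> by (simp add: det_dim_zero)
next
  case (Suc k)
  let ?S = "{T. T \<in> arrays n k \<and> (\<forall>i<k. x i \<le> T (Suc i, Suc i) \<and> T (Suc i, Suc i) \<le> x (Suc i))}"
  let ?Y = "\<Pi>\<^sub>E i\<in>{..<k}. letters n \<inter> {x i..x (Suc i)}"
  let ?W = "\<lambda>y. \<Prod>i<k. interlace_wt t (x i) (y i) (x (Suc i))"
  let ?p = "\<Prod>i<Suc k. lower_wt t (x i)"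
  let ?diag = "\<lambda>T. restrict (\<lambda>i. T (Suc i, Suc i)) {..<k}"
  have inner: "(\<Sum>T | T \<in> arrays n k \<and> (\<forall>i<k. T (Suc i, Suc i) = y i). \<Prod>b\<in>SF k. box_wt t T b)
      = det (mat k k (\<lambda>(i, j). ladder n t j (y i)))" if y: "y \<in> ?Y" for y
  proof (cases "\<forall>i. Suc i < k \<longrightarrow> y i < y (Suc i)")
    case True
    have "y i \<in> letters n" if "i < k" for i using y that by (auto simp: PiE_def)
    then show ?thesis using Suc.IH[of y] True by blast
  next
    \<comment> \<open>Neighbouring intervals share an endpoint, so \<open>y\<close> may repeat a
      letter at consecutive places. No array has such a diagonal, and the determinant then has two
      equal rows: both sides are 0.\<close>
    case False
    then obtain i where i: "Suc i < k" "\<not> y i < y (Suc i)" by blast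
    have "y i \<le> x (Suc i)" "x (Suc i) \<le> y (Suc i)"
      using y i(1) by (auto simp: PiE_def Pi_def)
    then have eq: "y i = y (Suc i)" using i(2) by simp
    have "{T. T \<in> arrays n k \<and> (\<forall>i<k. T (Suc i, Suc i) = y i)} = {}"
    proof safe
      fix T assume T: "T \<in> arrays n k" "\<forall>i<k. T (Suc i, Suc i) = y i"
      have "T (Suc i, Suc i) < T (Suc (Suc i), Suc (Suc i))"
        using T(1) i(1) by (simp add: arrays_def)
      then show "T \<in> {}" using T(2) i(1) eq by simp
    qed
    moreover have "det (mat k k (\<lambda>(i, j). ladder n t j (y i))) = 0"
      by (rule det_identical_rows[of _ k i "Suc i"]) (use i eq in auto)
    ultimately show ?thesis by (simp only: sum.empty)
  qed
  have "(\<Sum>T | T \<in> arrays n (Suc k) \<and> (\<forall>i<Suc k. T (Suc i, Suc i) = x i). \<Prod>b\<in>SF (Suc k). box_wt t T b)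
      = (\<Sum>T\<in>?S. ?p * (?W (\<lambda>i. T (Suc i, Suc i)) * (\<Prod>b\<in>SF k. box_wt t T b)))"
  proof (rule sum.reindex_bij_witness[of _ "add_diagonal k x" "drop_diagonal k"])
    fix T assume T: "T \<in> {T. T \<in> arrays n (Suc k) \<and> (\<forall>i<Suc k. T (Suc i, Suc i) = x i)}"
    then have eq: "add_diagonal k x (drop_diagonal k T) = T"
      by (auto intro: add_drop_diagonal)
    then show "add_diagonal k x (drop_diagonal k T) = T" .
    have "x i \<le> drop_diagonal k T (Suc i, Suc i) \<and> drop_diagonal k T (Suc i, Suc i) \<le> x (Suc i)"
      if i: "i < k" for i
    proof -
      have T': "T \<in> arrays n (Suc k)"
        using T by simp
      then have "T (Suc i, Suc i) \<le> T (Suc i, Suc (Suc i))" "T (Suc i, Suc (Suc i)) \<le> T (Suc (Suc i), Suc (Suc i))"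
        using T' i by (auto simp: arrays_def)
      then show ?thesis using T i by (simp add: drop_diagonal_def)
    qed
    then show "drop_diagonal k T \<in> ?S"
      using T by (auto intro: drop_diagonal_in_arrays)
    show "?p * (?W (\<lambda>i. drop_diagonal k T (Suc i, Suc i)) * (\<Prod>b\<in>SF k. box_wt t (drop_diagonal k T) b))
        = (\<Prod>b\<in>SF (Suc k). box_wt t T b)"
      using box_wt_add_diagonal[of t k x "drop_diagonal k T"] unfolding eq by simp
  next
    fix T assume T: "T \<in> ?S"
    then show "drop_diagonal k (add_diagonal k x T) = T"
      by (auto intro: drop_add_diagonal)
    have "add_diagonal k x T \<in> arrays n (Suc k)"
      using T Suc.prems by (intro add_diagonal_in_arrays) auto
    then show "add_diagonal k x T \<in> {T. T \<in> arrays n (Suc k) \<and> (\<forall>i<Suc k. T (Suc i, Suc i) = x i)}"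
      by (auto simp: add_diagonal_def)
  qed
  also have "\<dots> = ?p * (\<Sum>T\<in>?S. ?W (?diag T) * (\<Prod>b\<in>SF k. box_wt t T b))"
    by (simp add: sum_distrib_left del: prod.lessThan_Suc)
  also have "(\<Sum>T\<in>?S. ?W (?diag T) * (\<Prod>b\<in>SF k. box_wt t T b))
      = (\<Sum>y\<in>?Y. \<Sum>T\<in>{T \<in> ?S. ?diag T = y}. ?W (?diag T) * (\<Prod>b\<in>SF k. box_wt t T b))"
  proof (rule sum.group[symmetric])
    show "finite ?S" by (rule finite_subset[OF _ finite_arrays[of n k]]) auto
    show "finite ?Y" using finite_letters by (intro finite_PiE) auto
    show "?diag ` ?S \<subseteq> ?Y"
      by (auto simp: arrays_def PiE_def Pi_def)
  qed
  also have "\<dots> = (\<Sum>y\<in>?Y. ?W y *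
      (\<Sum>T | T \<in> arrays n k \<and> (\<forall>i<k. T (Suc i, Suc i) = y i). \<Prod>b\<in>SF k. box_wt t T b))"
  proof (rule sum.cong[OF refl])
    fix y assume y: "y \<in> ?Y"
    have "?diag T = y \<longleftrightarrow> (\<forall>i<k. T (Suc i, Suc i) = y i)" for T :: "box \<Rightarrow> letter"
      using y by (auto simp: fun_eq_iff PiE_def extensional_def)
    then have "{T \<in> ?S. ?diag T = y} = {T. T \<in> arrays n k \<and> (\<forall>i<k. T (Suc i, Suc i) = y i)}"
      using y by (auto simp: PiE_def Pi_def)
    then show "(\<Sum>T\<in>{T \<in> ?S. ?diag T = y}. ?W (?diag T) * (\<Prod>b\<in>SF k. box_wt t T b)) = ?W y *
      (\<Sum>T | T \<in> arrays n k \<and> (\<forall>i<k. T (Suc i, Suc i) = y i). \<Prod>b\<in>SF k. box_wt t T b)"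
      by (auto simp: sum_distrib_left intro!: sum.cong)
  qed
  also have "\<dots> = (\<Sum>y\<in>?Y. ?W y * det (mat k k (\<lambda>(i, j). ladder n t j (y i))))"
    using inner by (intro sum.cong) auto
  also have "?p * \<dots> = det (mat (Suc k) (Suc k) (\<lambda>(i, j). ladder n t j (x i)))"
    using Suc.prems by (intro sum_interlacing_det) auto
  finally show ?case .
qed

section \<open>Evaluation of the final determinant\<close>

lemma ST_set_eq_arrays:
  "ST_set n = {T \<in> arrays n n. \<forall>i<n. T (Suc i, Suc i) \<in> {Barred (Suc i), Unbarred (Suc i)}}"
proof -
  have "(\<forall>i. (i, i) \<in> SF n \<longrightarrow> T (i, i) \<in> {Unbarred i, Barred i}) \<longleftrightarrow>
      (\<forall>i<n. T (Suc i, Suc i) \<in> {Barred (Suc i), Unbarred (Suc i)})" for T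
  proof (safe, goal_cases)
    case (1 i)
    then show ?case by (auto dest!: spec[of _ "Suc i"])
  next
    case (2 i)
    then show ?case by (auto dest!: spec[of _ "i - 1"])
  qed
  then show ?thesis
    unfolding ST_set_def arrays_def by (simp add: conj_ac) (auto simp: conj_ac)
qed

text \<open>The main diagonal boxes choose independently between two letters, and every choice is
  strictly increasing because the indices are. Multilinearity collects the determinants of all these
  choices into one.\<close>

lemma sum_ST_set_eq_det:
  fixes t :: "'b :: comm_ring_1"
  shows "(\<Sum>T\<in>ST_set n. \<Prod>b\<in>SF n. box_wt t T b)
    = det (mat n n (\<lambda>(i, j). ladder n t j (Barred (Suc i)) + ladder n t j (Unbarred (Suc i))))"
proof -
  let ?D = "\<lambda>i. {Barred (Suc i), Unbarred (Suc i)}"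
  let ?X = "\<Pi>\<^sub>E i\<in>{..<n}. ?D i"
  let ?diag = "\<lambda>T. restrict (\<lambda>i. T (Suc i, Suc i)) {..<n}"
  have "(\<Sum>T\<in>ST_set n. \<Prod>b\<in>SF n. box_wt t T b)
      = (\<Sum>x\<in>?X. \<Sum>T\<in>{T \<in> ST_set n. ?diag T = x}. \<Prod>b\<in>SF n. box_wt t T b)"
  proof (rule sum.group[symmetric])
    show "finite ?X" by (intro finite_PiE) auto
    show "?diag ` ST_set n \<subseteq> ?X" by (auto simp: ST_set_eq_arrays PiE_def Pi_def)
  qed (rule finite_ST_set)
  also have "\<dots> = (\<Sum>x\<in>?X. det (mat n n (\<lambda>(i, j). ladder n t j (x i))))"
  proof (rule sum.cong[OF refl])
    fix x assume x: "x \<in> ?X"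
    have "?diag T = x \<longleftrightarrow> (\<forall>i<n. T (Suc i, Suc i) = x i)" for T :: "box \<Rightarrow> letter"
      using x by (auto simp: fun_eq_iff PiE_def extensional_def)
    then have eq: "{T \<in> ST_set n. ?diag T = x} = {T. T \<in> arrays n n \<and> (\<forall>i<n. T (Suc i, Suc i) = x i)}"
      using x by (auto simp: ST_set_eq_arrays PiE_def Pi_def)
    have xD: "x i \<in> ?D i" if "i < n" for i using x that by (auto simp: PiE_def Pi_def)
    show "(\<Sum>T\<in>{T \<in> ST_set n. ?diag T = x}. \<Prod>b\<in>SF n. box_wt t T b)
        = det (mat n n (\<lambda>(i, j). ladder n t j (x i)))"
      unfolding eq
    proof (rule sum_arrays_diagonal)
      show "x i \<in> letters n" if "i < n" for i
        using xD[OF that] that by (auto simp: letters_def)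
      show "x i < x (Suc i)" if "Suc i < n" for i
        using xD[of i] xD[of "Suc i"] that by (auto simp: less_letter_def)
    qed
  qed
  also have "\<dots> = det (mat n n (\<lambda>(i, j). \<Sum>c\<in>?D i. 1 * ladder n t j c))"
    by (subst det_row_sums) auto
  finally show ?thesis by simp
qed

section \<open>Binomial expansion of the determinant entries\<close>

text \<open>Let \<open>F\<^sub>j(k)\<close> be the sum of \<open>ladder n t j\<close> over \<open>Barred k\<close> and \<open>Unbarred k\<close>.  The combination
  \<open>Barred - t * Unbarred\<close> at level \<open>j\<close> is \<open>- t\<^sup>2 F\<^sub>j\<^sub>-\<^sub>1(k)\<close>, which closes the recursion for \<open>F\<close>; below
  are the coefficients of \<open>F\<^sub>j(i + 1)\<close> in the basis \<open>i choose l\<close>.\<close>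

fun ladder_coeff :: "'b \<Rightarrow> nat \<Rightarrow> nat \<Rightarrow> 'b :: comm_ring_1" where
  "ladder_coeff t 0 l = (if l = 0 then 1 + t else 0)"
| "ladder_coeff t (Suc j) l =
    (1 + t)\<^sup>2 * (if l = 0 then 0 else ladder_coeff t j (l - 1)) + 2 * t * ladder_coeff t j l
      - (if j = 0 then 0 else t\<^sup>2 * ladder_coeff t (j - 1) l)"

lemma ladder_coeff_eq_0: "j < l \<Longrightarrow> ladder_coeff t j l = 0"
  by (induction t j l rule: ladder_coeff.induct) auto

text \<open>Only the first summand of the recursion reaches the top coefficient, so each level
  multiplies it by \<open>(1 + t)\<^sup>2\<close>.\<close>

lemma ladder_coeff_diag: "ladder_coeff t j j = (1 + t) ^ (2 * j + 1)"
proof (induction j)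
  case (Suc j)
  then show ?case
    by (simp add: ladder_coeff_eq_0 power_add power2_eq_square algebra_simps)
qed simp

lemma letters_less_Barred:
  assumes "k \<le> n"
  shows "{y. y \<in> letters n \<and> y < Barred k} = Barred ` {1..<k} \<union> Unbarred ` {1..<k}"
  using assms by (auto simp: letters_def less_letter_def)

lemma letters_less_Unbarred:
  assumes "1 \<le> k" "k \<le> n"
  shows "{y. y \<in> letters n \<and> y < Unbarred k} = insert (Barred k) {y. y \<in> letters n \<and> y < Barred k}"
  using assms by (auto simp: letters_def less_letter_def)

lemma sum_binomial_less: "(\<Sum>m<i. m choose l) = i choose Suc l"
  by (induction i) auto

lemma ladder_pair_Suc:
  fixes t :: "'b :: comm_ring_1"
  assumes "1 \<le> k" "k \<le> n"
  defines "F \<equiv> \<lambda>j k. ladder n t j (Barred k) + ladder n t j (Unbarred k)"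
  shows "F (Suc j) k = (1 + t)\<^sup>2 * (\<Sum>l\<in>{1..<k}. F j l) + 2 * t * F j k
      - (if j = 0 then 0 else t\<^sup>2 * F (j - 1) k)"
proof -
  define S where "S j = (\<Sum>l\<in>{1..<k}. F j l)" for j
  have B: "(\<Sum>y | y \<in> letters n \<and> y < Barred k. ladder n t j y) = S j" for j
    unfolding letters_less_Barred[OF assms(2)] S_def F_def
    by (subst sum.union_disjoint) (auto simp: sum.reindex inj_on_def sum.distrib)
  have fin: "finite {y. y \<in> letters n \<and> y < Barred k}"
    using finite_letters by simp
  have U: "(\<Sum>y | y \<in> letters n \<and> y < Unbarred k. ladder n t j y) = ladder n t j (Barred k) + S j" for j
    unfolding letters_less_Unbarred[OF assms(1,2)] using fin B by (simp add: less_letter_def)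
  have SucB: "ladder n t (Suc j) (Barred k) = t * ((1 + t) * S j + ladder n t j (Barred k))" for j
    by (simp add: B)
  have SucU: "ladder n t (Suc j) (Unbarred k)
      = (1 + t) * (ladder n t j (Barred k) + S j) + t * ladder n t j (Unbarred k)" for j
    by (simp add: U)
  \<comment> \<open>This combination is what remains after the multiples of \<open>S j\<close> and
    \<open>F j k\<close> are split off. For positive \<open>j\<close> it reduces to the level below;
    for \<open>j = 0\<close> it is \<open>t - t = 0\<close>, whence the case distinction.\<close>
  have C: "ladder n t j (Barred k) - t * ladder n t j (Unbarred k)
      = - (if j = 0 then 0 else t\<^sup>2 * F (j - 1) k)"
  proof (cases j)
    case (Suc i)
    show ?thesis
      unfolding Suc SucB SucU by (simp add: F_def power2_eq_square algebra_simps)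
  qed simp
  have "F (Suc j) k = (1 + t)\<^sup>2 * S j + 2 * t * F j k
      + (ladder n t j (Barred k) - t * ladder n t j (Unbarred k))"
    unfolding F_def SucB SucU by (simp add: power2_eq_square algebra_simps)
  then show ?thesis
    unfolding C S_def by simp
qed

text \<open>Summing over smaller row indices sends \<open>i choose l\<close> to
  \<open>i choose Suc l\<close>, so the recursion for the pairs becomes that of
  \<open>ladder_coeff\<close>. A common bound \<open>N\<close> gives all levels the same range of
  \<open>l\<close>, as a factorization into two square matrices requires.\<close>

lemma ladder_pair_binomial:
  fixes t :: "'b :: comm_ring_1"
  assumes "i < n" "j < N"
  shows "ladder n t j (Barred (Suc i)) + ladder n t j (Unbarred (Suc i))
    = (\<Sum>l<N. of_nat (i choose l) * ladder_coeff t j l)"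
  using assms
proof (induction j arbitrary: i rule: less_induct)
  case (less j)
  define F where "F j k = ladder n t j (Barred k) + ladder n t j (Unbarred k)" for j k
  define P where "P j i = (\<Sum>l<N. of_nat (i choose l) * ladder_coeff t j l)" for j i
  have IH: "F j' (Suc i') = P j' i'" if "j' < j" "i' < n" for j' i'
    using less.IH[OF that] less.prems that by (simp add: F_def P_def)
  have "F j (Suc i) = P j i"
  proof (cases j)
    case 0
    then show ?thesis
      using less.prems by (simp add: F_def P_def if_distrib cong: if_cong)
  next
    case (Suc j')
    have N: "N = Suc (N - 1)" using less.prems by simp
    define u where "u l = (if l = 0 then 0 else ladder_coeff t j' (l - 1))" for l
    have "(\<Sum>l\<in>{1..<Suc i}. F j' l) = (\<Sum>m<i. F j' (Suc m))"
      by (simp only: One_nat_def sum.shift_bounds_Suc_ivl atLeast0LessThan)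
    also have "\<dots> = (\<Sum>m<i. P j' m)"
      using less.prems Suc by (intro sum.cong) (auto simp: IH)
    also have "\<dots> = (\<Sum>l<N. (\<Sum>m<i. of_nat (m choose l)) * ladder_coeff t j' l)"
      unfolding P_def by (subst sum.swap) (simp add: sum_distrib_right)
    also have "\<dots> = (\<Sum>l<N. of_nat (i choose Suc l) * ladder_coeff t j' l)"
      by (simp add: sum_binomial_less flip: of_nat_sum)
    \<comment> \<open>The term \<open>l = N - 1\<close> is 0 because \<open>j' < N - 1\<close>.
      Dropping it makes room for the index shift to \<open>u\<close>, whose value at 0 is 0.\<close>
    also have "\<dots> = (\<Sum>l<N - 1. of_nat (i choose Suc l) * ladder_coeff t j' l)"
      using less.prems Suc by (subst N, subst sum.lessThan_Suc) (simp add: ladder_coeff_eq_0)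
    also have "\<dots> = (\<Sum>l<N. of_nat (i choose l) * u l)"
      unfolding u_def by (subst (2) N, subst sum.lessThan_Suc_shift) simp
    finally have S: "(\<Sum>l\<in>{1..<Suc i}. F j' l) = (\<Sum>l<N. of_nat (i choose l) * u l)" .
    have coeff: "ladder_coeff t (Suc j') l = (1 + t)\<^sup>2 * u l + 2 * t * ladder_coeff t j' l
        - (if j' = 0 then 0 else t\<^sup>2 * ladder_coeff t (j' - 1) l)" for l
      by (simp add: u_def)
    have "F j (Suc i) = (1 + t)\<^sup>2 * (\<Sum>l\<in>{1..<Suc i}. F j' l) + 2 * t * F j' (Suc i)
        - (if j' = 0 then 0 else t\<^sup>2 * F (j' - 1) (Suc i))"
      unfolding Suc F_def by (rule ladder_pair_Suc) (use less.prems in auto)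
    also have "\<dots> = (1 + t)\<^sup>2 * (\<Sum>l<N. of_nat (i choose l) * u l)
        + 2 * t * P j' i - (if j' = 0 then 0 else t\<^sup>2 * P (j' - 1) i)"
      unfolding S using IH[of j' i] IH[of "j' - 1" i] less.prems Suc by simp
    also have "\<dots> = P j i"
      unfolding P_def Suc coeff
      by (cases "j' = 0") (simp_all add: sum_distrib_left sum.distrib sum_subtractf algebra_simps)
    finally show ?thesis .
  qed
  then show ?case by (simp add: F_def P_def)
qed

lemma sum_odd_numbers: "(\<Sum>j<n. 2 * j + 1) = n\<^sup>2" for n :: nat
  by (induction n) (auto simp: power2_eq_square)

text \<open>The matrix factors into a lower unitriangular Pascal matrix and the upper triangular
  matrix of coefficients, whose diagonal consists of the odd powers of \<open>1 + t\<close>; the odd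
  numbers below \<open>2 * n\<close> add up to \<open>n\<^sup>2\<close>.\<close>

lemma sum_ST_set_box_wt:
  fixes t :: "'b :: comm_ring_1"
  shows "(\<Sum>T\<in>ST_set n. \<Prod>b\<in>SF n. box_wt t T b) = (1 + t) ^ (n\<^sup>2)"
proof -
  let ?B = "mat n n (\<lambda>(i, l). of_nat (i choose l) :: 'b)"
  let ?C = "mat n n (\<lambda>(l, j). ladder_coeff t j l)"
  have "mat n n (\<lambda>(i, j). ladder n t j (Barred (Suc i)) + ladder n t j (Unbarred (Suc i))) = ?B * ?C"
    by (rule eq_matI) (auto simp: ladder_pair_binomial[where N = n] scalar_prod_def atLeast0LessThan)
  then have "(\<Sum>T\<in>ST_set n. \<Prod>b\<in>SF n. box_wt t T b) = det ?B * det ?C"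
    by (simp add: sum_ST_set_eq_det det_mult[of _ n])
  also have "det ?B = 1"
    by (subst det_lower_triangular[of n]) (auto simp: prod_list_diag_prod binomial_eq_0)
  also have "det ?C = (\<Prod>j<n. (1 + t) ^ (2 * j + 1))"
    by (subst det_upper_triangular[of _ n])
      (auto simp: prod_list_diag_prod upper_triangular_def ladder_coeff_eq_0 ladder_coeff_diag
        atLeast0LessThan simp del: power_Suc intro!: prod.cong)
  also have "\<dots> = (1 + t) ^ (n\<^sup>2)"
    by (simp only: sum_odd_numbers flip: power_sum)
  finally show ?thesis by simp
qed

section \<open>Statistics of shifted tableaux\<close>

text \<open>The map \<open>nxt\<close> orients the adjacency graph of \<open>B\<close> as a forest:
  every edge joins a box to its successor, and \<open>m\<close> decreases along proper steps. So
  each component contains exactly one fixed point.\<close>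

lemma card_components_roots:
  fixes nxt :: "box \<Rightarrow> box" and m :: "box \<Rightarrow> nat"
  assumes closed: "\<And>b. b \<in> B \<Longrightarrow> nxt b \<in> B"
    and step: "\<And>b. b \<in> B \<Longrightarrow> nxt b = b \<or> edge_adjacent b (nxt b) \<and> m (nxt b) < m b"
    and adj: "\<And>b b'. b \<in> B \<Longrightarrow> b' \<in> B \<Longrightarrow> edge_adjacent b b' \<Longrightarrow> nxt b = b' \<or> nxt b' = b"
  shows "card (components B) = card {b \<in> B. nxt b = b}"
proof -
  let ?R = "(adj_in B)\<^sup>*" and ?roots = "{b \<in> B. nxt b = b}"
  have root: "\<exists>r\<in>?roots. (b, r) \<in> ?R" if "b \<in> B" for b
    using that
  proof (induction "m b" arbitrary: b rule: less_induct)
    case less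
    show ?case
    proof (cases "nxt b = b")
      case False
      then have "edge_adjacent b (nxt b)" "m (nxt b) < m b"
        using step[of b] less.prems by simp_all
      moreover from this obtain r where "r \<in> ?roots" "(nxt b, r) \<in> ?R"
        using less.hyps closed less.prems by blast
      moreover have "(b, nxt b) \<in> adj_in B"
        using closed less.prems calculation(1) by (simp add: adj_in_def)
      ultimately show ?thesis
        by (blast intro: converse_rtrancl_into_rtrancl)
    qed (use less.prems in blast)
  qed
  \<comment> \<open>Every box of the component of a root \<open>r\<close> is carried to
    \<open>r\<close> by some iterate of \<open>nxt\<close>, which makes the root of a component
    unique.\<close>
  have to_root: "\<exists>k. (nxt ^^ k) b = r" if "(r, b) \<in> ?R" "nxt r = r" for r b
    using that
  proof (induction rule: rtrancl_induct)
    case base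
    have "(nxt ^^ 0) r = r" by simp
    then show ?case by blast
  next
    case (step b b')
    then obtain k where k: "(nxt ^^ k) b = r" by blast
    have "nxt b = b' \<or> nxt b' = b"
      using step adj by (auto simp: adj_in_def)
    then show ?case
    proof
      assume "nxt b' = b"
      then have "(nxt ^^ Suc k) b' = r"
        using k by (simp add: funpow_swap1)
      then show ?thesis by blast
    next
      assume b': "nxt b = b'"
      \<comment> \<open>The same exponent \<open>k\<close> works: the iterate commutes with
        \<open>nxt\<close>, and one extra step at the fixed point \<open>r\<close> does not move it.
        This covers \<open>k = 0\<close> as well.\<close>
      have "(nxt ^^ k) b' = nxt r"
        unfolding b'[symmetric] k[symmetric] by (simp add: funpow_swap1)
      then show ?thesis using step.prems by auto
    qed
  qed
  have "bij_betw (\<lambda>r. ?R `` {r}) ?roots (components B)"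
    unfolding bij_betw_def
  proof
    show "inj_on (\<lambda>r. ?R `` {r}) ?roots"
    proof (rule inj_onI)
      fix r r' assume r: "r \<in> ?roots" "r' \<in> ?roots" "?R `` {r} = ?R `` {r'}"
      then have "(r, r') \<in> ?R" by blast
      then obtain k where k: "(nxt ^^ k) r' = r"
        using to_root r(1) by blast
      have "(nxt ^^ k) r' = r'"
        using r(2) by (induction k) auto
      then show "r = r'" using k by simp
    qed
    show "(\<lambda>r. ?R `` {r}) ` ?roots = components B"
    proof
      show "components B \<subseteq> (\<lambda>r. ?R `` {r}) ` ?roots"
      proof
        fix X assume "X \<in> components B"
        then obtain b where b: "b \<in> B" "X = ?R `` {b}"
          by (auto simp: components_def quotient_def)
        then obtain r where "r \<in> ?roots" "(b, r) \<in> ?R"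
          using root by blast
        then show "X \<in> (\<lambda>r. ?R `` {r}) ` ?roots"
          using class_eq[of b r B] b by blast
      qed
    qed (auto simp: components_def quotient_def)
  qed
  then show ?thesis
    by (simp add: bij_betw_same_card)
qed

section \<open>Ribbons of equal letters\<close>

definition left_eq :: "(box \<Rightarrow> letter) \<Rightarrow> box \<Rightarrow> bool" where
  "left_eq T = (\<lambda>(i, j). i < j \<and> T (i, j - 1) = T (i, j))"

definition below_eq :: "(box \<Rightarrow> letter) \<Rightarrow> box \<Rightarrow> bool" where
  "below_eq T = (\<lambda>(i, j). i < j \<and> T (Suc i, j) = T (i, j))"

lemma ST_diag_less:
  assumes "T \<in> ST_set n" "1 \<le> i" "i \<le> j" "j < n"
  shows "T (i, j) < T (Suc i, Suc j)"
  using assms by (auto simp: ST_set_eq_arrays arrays_def)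

text \<open>The left neighbour and the box below are diagonally adjacent, so their letters differ
  strictly.\<close>

lemma not_left_eq_and_below_eq:
  assumes "T \<in> ST_set n" "b \<in> SF n"
  shows "\<not> (left_eq T b \<and> below_eq T b)"
proof
  obtain i j where b: "b = (i, j)" by (cases b)
  assume *: "left_eq T b \<and> below_eq T b"
  then have "T (i, j - 1) < T (Suc i, Suc (j - 1))"
    using assms by (intro ST_diag_less) (auto simp: b left_eq_def)
  then show False using * by (auto simp: b left_eq_def below_eq_def)
qed

text \<open>Following equal letters to the left or downwards is a successor map: at most one of the
  two moves is possible, each lowers \<open>j - i\<close>, and every adjacency of equal letters is
  such a move. The roots are the south-western ends.\<close>

lemma con_eq_card_tails:
  assumes T: "T \<in> ST_set n"
  shows "con n c T = card {b \<in> SF n. T b = c \<and> \<not> left_eq T b \<and> \<not> below_eq T b}"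
proof -
  define nxt where "nxt = (\<lambda>(i, j). if left_eq T (i, j) then (i, j - 1)
    else if below_eq T (i, j) then (Suc i, j) else (i, j))"
  have "con n c T = card {b \<in> boxes n T c. nxt b = b}"
    unfolding con_def
  proof (rule card_components_roots[where m = "\<lambda>(i, j). j - i"])
    fix b assume "b \<in> boxes n T c"
    then show "nxt b \<in> boxes n T c"
      by (cases b) (auto simp: nxt_def boxes_def left_eq_def below_eq_def)
    show "nxt b = b \<or> edge_adjacent b (nxt b) \<and> (case nxt b of (i, j) \<Rightarrow> j - i) < (case b of (i, j) \<Rightarrow> j - i)"
      by (cases b) (auto simp: nxt_def edge_adjacent_def left_eq_def below_eq_def)
  next
    have right: "nxt (i, Suc j) = (i, j)" if "(i, j) \<in> boxes n T c" "(i, Suc j) \<in> boxes n T c" for i j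
      using that by (auto simp: boxes_def nxt_def left_eq_def)
    have down: "nxt (i, j) = (Suc i, j)" if "(i, j) \<in> boxes n T c" "(Suc i, j) \<in> boxes n T c" for i j
    proof -
      have "below_eq T (i, j)" "(i, j) \<in> SF n"
        using that by (auto simp: boxes_def below_eq_def)
      then show ?thesis
        using not_left_eq_and_below_eq[OF T] by (auto simp: nxt_def)
    qed
    fix b b' assume b: "b \<in> boxes n T c" "b' \<in> boxes n T c" "edge_adjacent b b'"
    then show "nxt b = b' \<or> nxt b' = b"
      by (cases b; cases b') (auto simp: edge_adjacent_def right down)
  qed
  also have "{b \<in> boxes n T c. nxt b = b} = {b \<in> SF n. T b = c \<and> \<not> left_eq T b \<and> \<not> below_eq T b}"
    by (auto simp: boxes_def nxt_def left_eq_def below_eq_def split: if_splits)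
  finally show ?thesis .
qed

text \<open>By monotonicity the boxes of a row with letter \<open>c\<close> are contiguous, so
  exactly one of them, the leftmost, lacks an equal left neighbour.\<close>

lemma card_rows_eq:
  assumes T: "T \<in> ST_set n"
  shows "card {i. \<exists>j. (i, j) \<in> SF n \<and> T (i, j) = c} = card {b \<in> SF n. T b = c \<and> \<not> left_eq T b}"
proof -
  let ?L = "{b \<in> SF n. T b = c \<and> \<not> left_eq T b}"
  have leftmost: "j \<le> j'" if "(i, j) \<in> ?L" "(i, j') \<in> SF n" "T (i, j') = c" for i j j'
  proof (rule ccontr)
    assume "\<not> j \<le> j'"
    then have *: "j' \<le> j - 1" "j - 1 \<le> n" "i < j" "(i, j - 1) \<in> SF n" "j - 1 \<le> j" "j \<le> n"
      using that by auto
    have "T (i, j') \<le> T (i, j - 1)" "T (i, j - 1) \<le> T (i, j)"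
      using ST_row_mono[OF T that(2) *(1,2)] ST_row_mono[OF T *(4-6)] by auto
    then show False using that * by (auto simp: left_eq_def)
  qed
  have "bij_betw fst ?L {i. \<exists>j. (i, j) \<in> SF n \<and> T (i, j) = c}"
    unfolding bij_betw_def
  proof
    show "inj_on fst ?L"
    proof (rule inj_onI)
      fix b b' assume b: "b \<in> ?L" "b' \<in> ?L" "fst b = fst b'"
      obtain i j j' where ij: "b = (i, j)" "b' = (i, j')"
        using b(3) by (cases b; cases b') auto
      show "b = b'"
        using leftmost[of i j j'] leftmost[of i j' j] b unfolding ij by simp
    qed
    show "fst ` ?L = {i. \<exists>j. (i, j) \<in> SF n \<and> T (i, j) = c}"
    proof (intro equalityI subsetI)
      fix i assume "i \<in> {i. \<exists>j. (i, j) \<in> SF n \<and> T (i, j) = c}"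
      then have ex: "\<exists>j. (i, j) \<in> SF n \<and> T (i, j) = c" by simp
      define j where "j = (LEAST j. (i, j) \<in> SF n \<and> T (i, j) = c)"
      have j: "(i, j) \<in> SF n \<and> T (i, j) = c"
        unfolding j_def by (rule LeastI_ex[OF ex])
      have "\<not> left_eq T (i, j)"
        using j not_less_Least[of "j - 1" "\<lambda>j. (i, j) \<in> SF n \<and> T (i, j) = c"]
        unfolding j_def[symmetric] by (auto simp: left_eq_def)
      then have "(i, j) \<in> ?L" using j by simp
      then show "i \<in> fst ` ?L" by force
    qed auto
  qed
  then show ?thesis
    by (simp add: bij_betw_same_card)
qed

lemma card_cols_eq:
  assumes T: "T \<in> ST_set n"
  shows "card {j. \<exists>i. (i, j) \<in> SF n \<and> T (i, j) = c} = card {b \<in> SF n. T b = c \<and> \<not> below_eq T b}"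
proof -
  let ?L = "{b \<in> SF n. T b = c \<and> \<not> below_eq T b}"
  have lowest: "i' \<le> i" if "(i, j) \<in> ?L" "(i', j) \<in> SF n" "T (i', j) = c" for i i' j
  proof (rule ccontr)
    assume "\<not> i' \<le> i"
    then have *: "1 \<le> i" "i \<le> Suc i" "(Suc i, j) \<in> SF n" "1 \<le> Suc i" "Suc i \<le> i'" "i < j"
      using that by auto
    have "T (i, j) \<le> T (Suc i, j)" "T (Suc i, j) \<le> T (i', j)"
      using ST_col_mono[OF T *(1-3)] ST_col_mono[OF T *(4,5) that(2)] by auto
    then show False using that * by (auto simp: below_eq_def)
  qed
  have "bij_betw snd ?L {j. \<exists>i. (i, j) \<in> SF n \<and> T (i, j) = c}"
    unfolding bij_betw_def
  proof
    show "inj_on snd ?L"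
    proof (rule inj_onI)
      fix b b' assume b: "b \<in> ?L" "b' \<in> ?L" "snd b = snd b'"
      obtain i i' j where ij: "b = (i, j)" "b' = (i', j)"
        using b(3) by (cases b; cases b') auto
      show "b = b'"
        using lowest[of i j i'] lowest[of i' j i] b unfolding ij by simp
    qed
    show "snd ` ?L = {j. \<exists>i. (i, j) \<in> SF n \<and> T (i, j) = c}"
    proof (intro equalityI subsetI)
      fix j assume "j \<in> {j. \<exists>i. (i, j) \<in> SF n \<and> T (i, j) = c}"
      then have ex: "\<exists>i. (i, j) \<in> SF n \<and> T (i, j) = c" by simp
      define i where "i = (GREATEST i. (i, j) \<in> SF n \<and> T (i, j) = c)"
      have bound: "\<And>i. (i, j) \<in> SF n \<and> T (i, j) = c \<Longrightarrow> i \<le> j" by simp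
      have i: "(i, j) \<in> SF n \<and> T (i, j) = c"
        unfolding i_def by (rule GreatestI_ex_nat[OF ex bound])
      have "\<not> below_eq T (i, j)"
        using i Greatest_le_nat[of "\<lambda>i. (i, j) \<in> SF n \<and> T (i, j) = c" "Suc i" j]
        unfolding i_def[symmetric] by (auto simp: below_eq_def)
      then have "(i, j) \<in> ?L" using i by simp
      then show "j \<in> snd ` ?L" by force
    qed auto
  qed
  then show ?thesis
    by (simp add: bij_betw_same_card)
qed

abbreviation is_barred :: "letter \<Rightarrow> bool" where
  "is_barred c \<equiv> \<exists>k. c = Barred k"

lemma ST_letters:
  assumes "T \<in> ST_set n" "b \<in> SF n"
  shows "T b \<in> letters n"
  using assms by (auto simp: ST_set_def)

text \<open>The leftmost boxes of an unbarred letter, one per row, are the ends of its ribbons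
  together with the boxes that continue downwards; subtracting the ribbons leaves the latter. For
  barred letters columns replace rows, and boxes that continue to the left remain.\<close>

lemma var_ST_eq:
  assumes T: "T \<in> ST_set n"
  shows "var_ST n T = card {b \<in> SF n. is_barred (T b) \<and> left_eq T b}
    + card {b \<in> SF n. \<not> is_barred (T b) \<and> below_eq T b}"
proof -
  let ?U = "\<lambda>k. {b \<in> SF n. T b = Unbarred k \<and> below_eq T b}"
  let ?V = "\<lambda>k. {b \<in> SF n. T b = Barred k \<and> left_eq T b}"
  have fin: "finite {b \<in> SF n. P b}" for P
    using finite_SF by simp
  have index: "\<exists>k\<in>{1..n}. T b = Unbarred k \<or> T b = Barred k" if "b \<in> SF n" for b
    using ST_letters[OF T that] by (auto simp: letters_def)
  have "row_ST n k T - con n (Unbarred k) T = card (?U k)" for k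
  proof -
    let ?C = "{b \<in> SF n. T b = Unbarred k \<and> \<not> left_eq T b \<and> \<not> below_eq T b}"
    have "{b \<in> SF n. T b = Unbarred k \<and> \<not> left_eq T b} = ?C \<union> ?U k"
      using not_left_eq_and_below_eq[OF T] by blast
    then have "row_ST n k T = card (?C \<union> ?U k)"
      using card_rows_eq[OF T] by (simp add: row_ST_def)
    also have "\<dots> = card ?C + card (?U k)"
      by (rule card_Un_disjoint[OF fin fin]) auto
    finally show ?thesis by (simp add: con_eq_card_tails[OF T])
  qed
  moreover have "col_ST n k T - con n (Barred k) T = card (?V k)" for k
  proof -
    let ?C = "{b \<in> SF n. T b = Barred k \<and> \<not> left_eq T b \<and> \<not> below_eq T b}"
    have "{b \<in> SF n. T b = Barred k \<and> \<not> below_eq T b} = ?C \<union> ?V k"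
      using not_left_eq_and_below_eq[OF T] by blast
    then have "col_ST n k T = card (?C \<union> ?V k)"
      using card_cols_eq[OF T] by (simp add: col_ST_def)
    also have "\<dots> = card ?C + card (?V k)"
      by (rule card_Un_disjoint[OF fin fin]) auto
    finally show ?thesis by (simp add: con_eq_card_tails[OF T])
  qed
  ultimately have "var_ST n T = (\<Sum>k=1..n. card (?U k)) + (\<Sum>k=1..n. card (?V k))"
    by (simp add: var_ST_def sum.distrib)
  also have "(\<Sum>k=1..n. card (?U k)) = card (\<Union>k\<in>{1..n}. ?U k)"
    by (rule card_UN_disjoint[symmetric]) (use fin in auto)
  also have "(\<Union>k\<in>{1..n}. ?U k) = {b \<in> SF n. \<not> is_barred (T b) \<and> below_eq T b}"
  proof (intro equalityI subsetI)
    fix b assume b: "b \<in> {b \<in> SF n. \<not> is_barred (T b) \<and> below_eq T b}"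
    then obtain k where "k \<in> {1..n}" "T b = Unbarred k"
      using index[of b] by auto
    then show "b \<in> (\<Union>k\<in>{1..n}. ?U k)"
      using b by blast
  qed auto
  also have "(\<Sum>k=1..n. card (?V k)) = card (\<Union>k\<in>{1..n}. ?V k)"
    by (rule card_UN_disjoint[symmetric]) (use fin in auto)
  also have "(\<Union>k\<in>{1..n}. ?V k) = {b \<in> SF n. is_barred (T b) \<and> left_eq T b}"
  proof (intro equalityI subsetI)
    fix b assume b: "b \<in> {b \<in> SF n. is_barred (T b) \<and> left_eq T b}"
    then obtain k where "k \<in> {1..n}" "T b = Barred k"
      using index[of b] by auto
    then show "b \<in> (\<Union>k\<in>{1..n}. ?V k)"
      using b by blast
  qed auto
  finally show ?thesis by simp
qed

text \<open>The \<open>n\<close> main diagonal boxes have neither a left neighbour nor a box below,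
  so they all end ribbons; removing them is the subtraction of \<open>n\<close>.\<close>

lemma str_ST_eq:
  assumes T: "T \<in> ST_set n"
  shows "str_ST n T - n = card {b \<in> SF n. fst b < snd b \<and> \<not> left_eq T b \<and> \<not> below_eq T b}"
proof -
  let ?C = "\<lambda>c. {b \<in> SF n. T b = c \<and> \<not> left_eq T b \<and> \<not> below_eq T b}"
  let ?O = "{b \<in> SF n. fst b < snd b \<and> \<not> left_eq T b \<and> \<not> below_eq T b}"
  have fin: "finite {b \<in> SF n. P b}" for P
    using finite_SF by simp
  have "str_ST n T = (\<Sum>c\<in>letters n. card (?C c))"
    by (simp add: str_ST_def con_eq_card_tails[OF T])
  also have "\<dots> = card (\<Union>c\<in>letters n. ?C c)"
    by (rule card_UN_disjoint[symmetric]) (use fin finite_letters in auto)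
  also have "(\<Union>c\<in>letters n. ?C c) = ?O \<union> (\<lambda>i. (i, i)) ` {1..n}"
    using ST_letters[OF T] by (auto simp: left_eq_def below_eq_def)
  also have "card \<dots> = card ?O + card ((\<lambda>i. (i, i)) ` {1..n})"
    by (rule card_Un_disjoint[OF fin]) auto
  also have "card ((\<lambda>i. (i, i)) ` {1..n}) = n"
    by (simp add: card_image inj_on_def)
  finally show ?thesis by simp
qed

section \<open>Factorization of the tableau weight over boxes\<close>

lemma prod_if_eq_power_card:
  assumes "finite S"
  shows "(\<Prod>b\<in>S. if P b then x else 1) = x ^ card {b \<in> S. P b}"
  using assms by (simp add: prod.If_cases Int_def)

lemma ST_weight_eq_prod:
  fixes t :: "'b :: comm_ring_1"
  assumes T: "T \<in> ST_set n"
  shows "t ^ (var_ST n T + bar_ST n T) * (1 + t) ^ (str_ST n T - n) = (\<Prod>b\<in>SF n. box_wt t T b)"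
proof -
  have "box_wt t T b = (if is_barred (T b) then t else 1) *
      (if is_barred (T b) \<and> left_eq T b then t else 1) *
      (if \<not> is_barred (T b) \<and> below_eq T b then t else 1) *
      (if fst b < snd b \<and> \<not> left_eq T b \<and> \<not> below_eq T b then 1 + t else 1)" if b: "b \<in> SF n" for b
  proof -
    obtain i j where ij: "b = (i, j)" by (cases b)
    have lower: "lower_wt t c = (if is_barred c then t else 1)"
      and upper: "upper_wt t c = (if is_barred c then 1 else t)" for c
      by (cases c; simp)+
    show ?thesis
      using not_left_eq_and_below_eq[OF T b]
      by (auto simp: ij box_wt_def interlace_wt_def left_eq_def below_eq_def lower upper)
  qed
  then have "(\<Prod>b\<in>SF n. box_wt t T b) = t ^ bar_ST n T
      * t ^ card {b \<in> SF n. is_barred (T b) \<and> left_eq T b}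
      * t ^ card {b \<in> SF n. \<not> is_barred (T b) \<and> below_eq T b}
      * (1 + t) ^ card {b \<in> SF n. fst b < snd b \<and> \<not> left_eq T b \<and> \<not> below_eq T b}"
    by (simp add: prod.distrib prod_if_eq_power_card finite_SF bar_ST_def)
  then show ?thesis
    by (simp add: var_ST_eq[OF T] str_ST_eq[OF T] power_add mult_ac)
qed

section \<open>U-turn matrices and square ice\<close>

text \<open>Zeros up to \<open>r\<close> make the suffix sum equal to the one from \<open>r\<close>,
  which is \<open>a r\<close> plus a suffix sum in {0, 1}. Staying in {0, 1} forces the total 1 if
  \<open>a r = 1\<close> and 0 if \<open>a r = - 1\<close>.\<close>

lemma sum_eq_if_nearest:
  fixes a :: "nat \<Rightarrow> int"
  assumes partial: "\<And>p. q < p \<Longrightarrow> p \<le> N \<Longrightarrow> (\<Sum>r=p..N. a r) \<in> {0, 1}"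
    and r: "q < r" "r \<le> N" "a r \<noteq> 0" "\<forall>s. q < s \<and> s < r \<longrightarrow> a s = 0"
  shows "(\<Sum>s=Suc q..N. a s) = (if a r = 1 then 1 else 0)" "a r \<in> {- 1, 1}"
proof -
  have "(\<Sum>s=Suc q..N. a s) = (\<Sum>s=r..N. a s)"
    using r by (intro sum.mono_neutral_right) auto
  moreover have "(\<Sum>s=r..N. a s) = a r + (\<Sum>s=Suc r..N. a s)"
    using r by (simp add: sum.atLeast_Suc_atMost)
  moreover have "(\<Sum>s=Suc r..N. a s) \<in> {0, 1}"
    using partial[of "Suc r"] r by (cases "Suc r \<le> N") auto
  moreover have "(\<Sum>s=r..N. a s) \<in> {0, 1}"
    using partial[of r] r by auto
  ultimately show "(\<Sum>s=Suc q..N. a s) = (if a r = 1 then 1 else 0)" "a r \<in> {- 1, 1}"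
    using r(3) by auto
qed

lemma sum_eq_0_if_no_nearest:
  fixes a :: "nat \<Rightarrow> int"
  assumes "\<And>r. q < r \<Longrightarrow> r \<le> N \<Longrightarrow> \<forall>s. q < s \<and> s < r \<longrightarrow> a s = 0 \<Longrightarrow> a r = 0"
  shows "(\<Sum>s=Suc q..N. a s) = 0"
proof -
  have "a r = 0" if "q < r" "r \<le> N" for r
    using that by (induction r rule: less_induct) (auto intro: assms)
  then show ?thesis by simp
qed

section \<open>U-turn matrices through their suffix sums\<close>

definition row_sum :: "nat \<Rightarrow> (nat \<times> nat \<Rightarrow> int) \<Rightarrow> nat \<Rightarrow> nat \<Rightarrow> int" where
  "row_sum n A i q = (\<Sum>p=q..n. A (i, p))"

definition col_sum :: "nat \<Rightarrow> (nat \<times> nat \<Rightarrow> int) \<Rightarrow> nat \<Rightarrow> nat \<Rightarrow> int" where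
  "col_sum n A i q = (\<Sum>r=i..2 * n. A (r, q))"

lemma row_sum_step: "q \<le> n \<Longrightarrow> row_sum n A i q = A (i, q) + row_sum n A i (Suc q)"
  by (simp add: row_sum_def sum.atLeast_Suc_atMost)

lemma col_sum_step: "i \<le> 2 * n \<Longrightarrow> col_sum n A i q = A (i, q) + col_sum n A (Suc i) q"
  by (simp add: col_sum_def sum.atLeast_Suc_atMost)

lemma row_sum_empty [simp]: "row_sum n A i (Suc n) = 0"
  by (simp add: row_sum_def)

lemma col_sum_empty [simp]: "col_sum n A (Suc (2 * n)) q = 0"
  by (simp add: col_sum_def)

lemma mem_positions [simp]: "(i, q) \<in> positions n \<longleftrightarrow> 1 \<le> i \<and> i \<le> 2 * n \<and> 1 \<le> q \<and> q \<le> n"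
  by (auto simp: positions_def)

text \<open>The conditions are rephrased by suffix sums alone; the range of an entry is recovered
  because it is the difference of two consecutive suffix sums of its row.\<close>

lemma mem_UA_set:
  "A \<in> UA_set n \<longleftrightarrow> A \<in> extensional (positions n) \<and> 
     (\<forall>i q. 1 \<le> i \<and> i \<le> 2 * n \<and> 1 \<le> q \<and> q \<le> n \<longrightarrow> row_sum n A i q \<in> {0, 1}) \<and>
     (\<forall>i q. 1 \<le> i \<and> i \<le> 2 * n \<and> 1 \<le> q \<and> q \<le> n \<longrightarrow> col_sum n A i q \<in> {0, 1}) \<and>
     (\<forall>i. 1 \<le> i \<and> i \<le> n \<longrightarrow> row_sum n A (2 * i - 1) 1 + row_sum n A (2 * i) 1 = 1) \<and>
     (\<forall>q. 1 \<le> q \<and> q \<le> n \<longrightarrow> col_sum n A 1 q = 1)"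
    (is "_ \<longleftrightarrow> ?E \<and> ?R \<and> ?C \<and> ?U \<and> ?T")
proof -
  have "A \<in> positions n \<rightarrow> {- 1, 0, 1}" if "?R"
  proof
    fix p assume "p \<in> positions n"
    then obtain i q where p: "p = (i, q)" "1 \<le> i" "i \<le> 2 * n" "1 \<le> q" "q \<le> n"
      by (cases p) auto
    have "row_sum n A i q \<in> {0, 1}" "row_sum n A i (Suc q) \<in> {0, 1}"
      using that p by (simp, cases "q = n") auto
    then show "A p \<in> {- 1, 0, 1}"
      using row_sum_step[of q n A i] p by auto
  qed
  then have "A \<in> UA_set n \<longleftrightarrow> ?E \<and> ?R \<and> ?C \<and>
      (\<forall>i\<in>{1..n}. (\<Sum>q=1..n. A (2 * i - 1, q) + A (2 * i, q)) = 1) \<and>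
      (\<forall>q\<in>{1..n}. (\<Sum>i=1..2 * n. A (i, q)) = 1)"
    unfolding UA_set_def PiE_def row_sum_def[symmetric] col_sum_def[symmetric]
    by (simp add: Ball_def) blast
  also have "(\<forall>i\<in>{1..n}. (\<Sum>q=1..n. A (2 * i - 1, q) + A (2 * i, q)) = 1) \<longleftrightarrow> ?U"
    by (simp add: sum.distrib row_sum_def Ball_def)
  also have "(\<forall>q\<in>{1..n}. (\<Sum>i=1..2 * n. A (i, q)) = 1) \<longleftrightarrow> ?T"
    by (simp add: col_sum_def Ball_def)
  finally show ?thesis .
qed

lemma UA_row_sum:
  assumes "A \<in> UA_set n" "1 \<le> i" "i \<le> 2 * n" "1 \<le> q" "q \<le> Suc n"
  shows "row_sum n A i q \<in> {0, 1}"
  using assms by (cases "q = Suc n") (auto simp: mem_UA_set)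

lemma UA_col_sum:
  assumes "A \<in> UA_set n" "1 \<le> i" "i \<le> Suc (2 * n)" "1 \<le> q" "q \<le> n"
  shows "col_sum n A i q \<in> {0, 1}"
  using assms by (cases "i = Suc (2 * n)") (auto simp: mem_UA_set)

lemma nearest_right_1_iff:
  assumes A: "A \<in> UA_set n" and p: "(i, q) \<in> positions n"
  shows "nearest_right n A (i, q) 1 \<longleftrightarrow> row_sum n A i (Suc q) = 1"
proof -
  have part: "(\<Sum>r=p..n. A (i, r)) \<in> {0, 1}" if "q < p" "p \<le> n" for p
    using UA_row_sum[OF A, of i p] that p by (simp add: row_sum_def)
  show ?thesis
  proof
    assume "nearest_right n A (i, q) 1"
    then show "row_sum n A i (Suc q) = 1"
      using sum_eq_if_nearest(1)[OF part] by (auto simp: nearest_right_def row_sum_def)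
  next
    assume *: "row_sum n A i (Suc q) = 1"
    obtain r where r: "q < r" "r \<le> n" "A (i, r) \<noteq> 0" "\<forall>s. q < s \<and> s < r \<longrightarrow> A (i, s) = 0"
      using sum_eq_0_if_no_nearest[of q n "\<lambda>r. A (i, r)"] * by (auto simp: row_sum_def)
    then have "A (i, r) = 1"
      using sum_eq_if_nearest(1)[OF part r] * by (auto simp: row_sum_def split: if_splits)
    then show "nearest_right n A (i, q) 1"
      using r by (auto simp: nearest_right_def)
  qed
qed

text \<open>A nearest entry -1 and a missing nonzero entry fall together because both make the
  column sum below the position 0.\<close>

lemma nearest_below_iff:
  assumes A: "A \<in> UA_set n" and p: "(i, q) \<in> positions n"
  shows "nearest_below n A (i, q) 1 \<longleftrightarrow> col_sum n A (Suc i) q = 1"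
    and "nearest_below n A (i, q) (- 1) \<or> \<not> (\<exists>x. nearest_below n A (i, q) x)
      \<longleftrightarrow> col_sum n A (Suc i) q = 0"
proof -
  have part: "(\<Sum>r=j..2 * n. A (r, q)) \<in> {0, 1}" if "i < j" "j \<le> 2 * n" for j
    using UA_col_sum[OF A, of j q] that p by (simp add: col_sum_def)
  have some: "col_sum n A (Suc i) q = (if x = 1 then 1 else 0) \<and> x \<in> {- 1, 1}"
    if "nearest_below n A (i, q) x" for x
    using that sum_eq_if_nearest[OF part] by (auto simp: nearest_below_def col_sum_def)
  have none: "col_sum n A (Suc i) q = 0" if "\<not> (\<exists>x. nearest_below n A (i, q) x)"
    unfolding col_sum_def
    by (rule sum_eq_0_if_no_nearest) (use that in \<open>auto simp: nearest_below_def\<close>)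
  show "nearest_below n A (i, q) 1 \<longleftrightarrow> col_sum n A (Suc i) q = 1"
    using some none by (metis insertE singletonD zero_neq_one)
  show "nearest_below n A (i, q) (- 1) \<or> \<not> (\<exists>x. nearest_below n A (i, q) x)
      \<longleftrightarrow> col_sum n A (Suc i) q = 0"
    using some none by (metis insertE singletonD zero_neq_one one_neq_neg_one)
qed

text \<open>A row suffix sum is 1 either because the entry is 1 and the rest sums to 0, or because
  the entry is 0 and the rest sums to 1, which is a positive zero.\<close>

lemma bar_UA_eq:
  assumes A: "A \<in> UA_set n"
  shows "bar_UA n A = card {(i, q). (i, q) \<in> positions n \<and> even i \<and> row_sum n A i q = 1}"
proof -
  have eq: "A (i, q) = 1 \<or> positive_zero n A (i, q) \<longleftrightarrow> row_sum n A i q = 1" if p: "(i, q) \<in> positions n" for i q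
    using UA_row_sum[OF A, of i q] UA_row_sum[OF A, of i "Suc q"] row_sum_step[of q n A i] p
    by (auto simp: positive_zero_def nearest_right_1_iff[OF A p])
  show ?thesis
    unfolding bar_UA_def
  proof (intro arg_cong[where f = card] Set.set_eqI)
    fix p :: "nat \<times> nat"
    obtain i q where "p = (i, q)" by (cases p)
    then show "p \<in> {p \<in> positions n. even (fst p) \<and> (A p = 1 \<or> positive_zero n A p)} \<longleftrightarrow>
        p \<in> {(i, q). (i, q) \<in> positions n \<and> even i \<and> row_sum n A i q = 1}"
      using eq[of i q] by auto
  qed
qed

lemma ssi_UA_eq:
  assumes A: "A \<in> UA_set n"
  shows "ssi_UA n A = card {(i, q). (i, q) \<in> positions n \<and> A (i, q) = 0 \<and> row_sum n A i q = 1 \<and>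
     col_sum n A i q = (if odd i then 1 else 0)}"
proof -
  have eq: "positive_zero n A (i, q) \<and>
      (odd i \<and> nearest_below n A (i, q) 1 \<or>
       even i \<and> (nearest_below n A (i, q) (- 1) \<or> \<not> (\<exists>x. nearest_below n A (i, q) x)))
    \<longleftrightarrow> A (i, q) = 0 \<and> row_sum n A i q = 1 \<and> col_sum n A i q = (if odd i then 1 else 0)"
    if p: "(i, q) \<in> positions n" for i q
    unfolding positive_zero_def nearest_right_1_iff[OF A p] nearest_below_iff[OF A p]
    using row_sum_step[of q n A i] col_sum_step[of i n A q] p by auto
  show ?thesis
    unfolding ssi_UA_def
  proof (intro arg_cong[where f = card] Set.set_eqI)
    fix p :: "nat \<times> nat"
    obtain i q where "p = (i, q)" by (cases p)
    then show "p \<in> {p \<in> positions n. positive_zero n A p \<and> (odd (fst p) \<and> nearest_below n A p 1 \<or>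
          even (fst p) \<and> (nearest_below n A p (- 1) \<or> \<not> (\<exists>x. nearest_below n A p x)))} \<longleftrightarrow>
        p \<in> {(i, q). (i, q) \<in> positions n \<and> A (i, q) = 0 \<and> row_sum n A i q = 1 \<and>
          col_sum n A i q = (if odd i then 1 else 0)}"
      using eq[of i q] by (simp only: mem_Collect_eq prod.case fst_conv) blast
  qed
qed

section \<open>Square ice as a description of U-turn matrices\<close>

lemma all_side: "(\<forall>d. P d) \<longleftrightarrow> P Up \<and> P Down \<and> P Left \<and> P Right" for P :: "side \<Rightarrow> bool"
  by (metis side.exhaust)

text \<open>Two edges in and two out is conservation of flow. The common value of the two
  differences is the matrix entry: 1 for \<open>WE\<close>, -1 for \<open>NS\<close>, and 0 for the
  four turning elements.\<close>

lemma ice_rule_iff: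
  "card (ins h v (i, q)) = 2 \<and> card (outs h v (i, q)) = 2 \<longleftrightarrow>
     (of_bool (h (i, q - 1)) - of_bool (h (i, q)) :: int) = of_bool (v (i, q)) - of_bool (v (i - 1, q))"
proof -
  have "ins h v (i, q) = (if v (i - 1, q) then {Up} else {}) \<union> (if v (i, q) then {} else {Down})
      \<union> (if h (i, q - 1) then {Left} else {}) \<union> (if h (i, q) then {} else {Right})"
    "outs h v (i, q) = (if v (i - 1, q) then {} else {Up}) \<union> (if v (i, q) then {Down} else {})
      \<union> (if h (i, q - 1) then {} else {Left}) \<union> (if h (i, q) then {Right} else {})"
    unfolding ins_def outs_def set_eq_iff all_side by auto
  then show ?thesis
    by (cases "v (i - 1, q)"; cases "v (i, q)"; cases "h (i, q - 1)"; cases "h (i, q)") simp_all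
qed

lemma ice_element_eq:
  assumes "card (ins h v (i, q)) = 2 \<and> card (outs h v (i, q)) = 2"
  shows "ice_element h v (i, q) =
    (if h (i, q - 1) then (if \<not> h (i, q) then WE else if v (i - 1, q) then SE else NE)
     else (if h (i, q) then NS else if v (i - 1, q) then SW else NW))"
  using assms[unfolded ice_rule_iff] unfolding ice_element_def ins_def outs_def set_eq_iff all_side
  by (cases "v (i - 1, q)"; cases "v (i, q)"; cases "h (i, q - 1)"; cases "h (i, q)") simp_all

definition UA_of_CM :: "nat \<Rightarrow> (nat \<times> nat \<Rightarrow> ice) \<Rightarrow> nat \<times> nat \<Rightarrow> int" where
  "UA_of_CM n C = restrict (\<lambda>p. if C p = WE then 1 else if C p = NS then - 1 else 0) (positions n)"

definition CM_of_UA :: "nat \<Rightarrow> (nat \<times> nat \<Rightarrow> int) \<Rightarrow> nat \<times> nat \<Rightarrow> ice" where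
  "CM_of_UA n A = restrict (ice_element (\<lambda>(i, q). row_sum n A i (Suc q) = 1)
     (\<lambda>(i, q). col_sum n A (Suc i) q \<noteq> 1)) (positions n)"

text \<open>An entry is a difference both of row sums and of column sums, which is the ice rule.
  Empty sums give the right and bottom boundaries, full column sums the top one, and the U-turn
  condition the left one.\<close>

lemma square_ice_of_UA:
  assumes A: "A \<in> UA_set n"
  shows "square_ice n (\<lambda>(i, q). row_sum n A i (Suc q) = 1) (\<lambda>(i, q). col_sum n A (Suc i) q \<noteq> 1)"
    (is "square_ice n ?h ?v")
proof -
  have "card (ins ?h ?v p) = 2 \<and> card (outs ?h ?v p) = 2" if p: "p \<in> positions n" for p
  proof -
    obtain i q where ij: "p = (i, q)" "1 \<le> i" "i \<le> 2 * n" "1 \<le> q" "q \<le> n"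
      using p by (cases p) auto
    show ?thesis
      unfolding ij(1) ice_rule_iff
      using UA_row_sum[OF A, of i q] UA_row_sum[OF A, of i "Suc q"] UA_col_sum[OF A, of i q]
        UA_col_sum[OF A, of "Suc i" q] row_sum_step[of q n A i] col_sum_step[of i n A q] ij
      by auto
  qed
  moreover have "row_sum n A (2 * i - 1) 1 = 1 \<longleftrightarrow> row_sum n A (2 * i) 1 \<noteq> 1" if "i \<in> {1..n}" for i
  proof -
    have "row_sum n A (2 * i - 1) 1 \<in> {0, 1}" "row_sum n A (2 * i) 1 \<in> {0, 1}"
      using that UA_row_sum[OF A, of "2 * i - 1" 1] UA_row_sum[OF A, of "2 * i" 1] by auto
    moreover have "row_sum n A (2 * i - 1) 1 + row_sum n A (2 * i) 1 = 1"
      using that A by (simp add: mem_UA_set)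
    ultimately show ?thesis by auto
  qed
  ultimately show ?thesis
    using A by (auto simp: square_ice_def mem_UA_set)
qed

text \<open>At a zero entry the flow does not change in either direction, so one row sum and one
  column sum decide among the four turning elements.\<close>

lemma CM_of_UA_eq:
  assumes A: "A \<in> UA_set n" and p: "(i, q) \<in> positions n"
  shows "CM_of_UA n A (i, q) =
    (if A (i, q) = 1 then WE else if A (i, q) = - 1 then NS
     else if row_sum n A i q = 1 then (if col_sum n A i q = 1 then NE else SE)
     else (if col_sum n A i q = 1 then NW else SW))"
proof -
  let ?h = "\<lambda>(i, q). row_sum n A i (Suc q) = 1" and ?v = "\<lambda>(i, q). col_sum n A (Suc i) q \<noteq> 1"
  have "card (ins ?h ?v (i, q)) = 2 \<and> card (outs ?h ?v (i, q)) = 2"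
    using square_ice_of_UA[OF A] p by (simp add: square_ice_def)
  note * = ice_element_eq[OF this]
  have "CM_of_UA n A (i, q) = ice_element ?h ?v (i, q)"
    unfolding CM_of_UA_def using p by simp
  then show ?thesis
    unfolding *
    using UA_row_sum[OF A, of i q] UA_row_sum[OF A, of i "Suc q"] row_sum_step[of q n A i] p
    by auto
qed

lemma UA_of_CM_of_UA:
  assumes A: "A \<in> UA_set n"
  shows "UA_of_CM n (CM_of_UA n A) = A"
proof
  fix p
  show "UA_of_CM n (CM_of_UA n A) p = A p"
  proof (cases "p \<in> positions n")
    case True
    then obtain i q where p: "p = (i, q)" "(i, q) \<in> positions n" by (cases p) auto
    have "A \<in> positions n \<rightarrow>\<^sub>E {- 1, 0, 1}" using A by (simp add: UA_set_def)
    then have "A p \<in> {- 1, 0, 1}" using True by auto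
    then show ?thesis
      using p by (auto simp: UA_of_CM_def CM_of_UA_eq[OF A])
  next
    case False
    then show ?thesis
      using A by (cases p) (auto simp: UA_of_CM_def mem_UA_set extensional_def)
  qed
qed

lemma CM_of_UA_in_CM_set: "A \<in> UA_set n \<Longrightarrow> CM_of_UA n A \<in> CM_set n"
  unfolding CM_set_def CM_of_UA_def using square_ice_of_UA by blast

text \<open>The entries are differences of edge indicators, so suffix sums telescope to the
  prescribed right and bottom boundary edges. Thus the matrix determines the orientation of every
  edge of the grid.\<close>

lemma sums_of_ice:
  assumes ice: "square_ice n h v"
  defines "A \<equiv> UA_of_CM n (restrict (ice_element h v) (positions n))"
  shows "\<lbrakk>1 \<le> i; i \<le> 2 * n; 1 \<le> q; q \<le> Suc n\<rbrakk> \<Longrightarrow> row_sum n A i q = of_bool (h (i, q - 1))"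
    and "\<lbrakk>1 \<le> q; q \<le> n; 1 \<le> i; i \<le> Suc (2 * n)\<rbrakk> \<Longrightarrow> col_sum n A i q = 1 - of_bool (v (i - 1, q))"
proof -
  have *: "A (i, q) = of_bool (h (i, q - 1)) - of_bool (h (i, q))"
    "A (i, q) = of_bool (v (i, q)) - of_bool (v (i - 1, q))" if "(i, q) \<in> positions n" for i q
  proof -
    have rule: "card (ins h v (i, q)) = 2 \<and> card (outs h v (i, q)) = 2"
      using ice that by (simp add: square_ice_def)
    show "A (i, q) = of_bool (h (i, q - 1)) - of_bool (h (i, q))"
      unfolding A_def UA_of_CM_def using that by (simp add: ice_element_eq[OF rule])
    then show "A (i, q) = of_bool (v (i, q)) - of_bool (v (i - 1, q))"
      using rule by (simp add: ice_rule_iff)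
  qed
  show "row_sum n A i q = of_bool (h (i, q - 1))" if "1 \<le> i" "i \<le> 2 * n" "1 \<le> q" "q \<le> Suc n"
    using that(4,3)
  proof (induction q rule: inc_induct)
    case base
    have "\<not> h (i, n)" using ice that by (simp add: square_ice_def)
    then show ?case by simp
  next
    case (step q)
    then show ?case using that by (simp add: row_sum_step *(1))
  qed
  show "col_sum n A i q = 1 - of_bool (v (i - 1, q))" if "1 \<le> q" "q \<le> n" "1 \<le> i" "i \<le> Suc (2 * n)"
    using that(4,3)
  proof (induction i rule: inc_induct)
    case base
    have "v (2 * n, q)" using ice that by (simp add: square_ice_def)
    then show ?case by simp
  next
    case (step i)
    then show ?case using that by (simp add: col_sum_step *(2))
  qed
qed

lemma UA_of_CM_in_UA_set:
  assumes "C \<in> CM_set n"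
  shows "UA_of_CM n C \<in> UA_set n" and "CM_of_UA n (UA_of_CM n C) = C"
proof -
  obtain h v where C: "C = restrict (ice_element h v) (positions n)" and ice: "square_ice n h v"
    using assms by (auto simp: CM_set_def)
  note sums = sums_of_ice[OF ice, folded C]
  have left: "h (2 * i - 1, 0) \<longleftrightarrow> \<not> h (2 * i, 0)" if "1 \<le> i" "i \<le> n" for i
    using ice that by (simp add: square_ice_def)
  have top: "\<not> v (0, q)" if "1 \<le> q" "q \<le> n" for q
    using ice that by (simp add: square_ice_def)
  show "UA_of_CM n C \<in> UA_set n"
    unfolding mem_UA_set
    using left top by (auto simp: sums) (simp_all add: UA_of_CM_def)
  show "CM_of_UA n (UA_of_CM n C) = C"
  proof
    fix p :: "nat \<times> nat"
    let ?h = "\<lambda>(i, q). row_sum n (UA_of_CM n C) i (Suc q) = 1"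
    let ?v = "\<lambda>(i, q). col_sum n (UA_of_CM n C) (Suc i) q \<noteq> 1"
    show "CM_of_UA n (UA_of_CM n C) p = C p"
    proof (cases "p \<in> positions n")
      case True
      then obtain i q where p: "p = (i, q)" "1 \<le> i" "i \<le> 2 * n" "1 \<le> q" "q \<le> n"
        by (cases p) auto
      \<comment> \<open>The orientation rebuilt from suffix sums is compared with \<open>h\<close>
        and \<open>v\<close> only on the four edges at a vertex of the grid, which is all that
        \<open>ice_element\<close> depends on.\<close>
      have "incoming ?h ?v (i, q) d = incoming h v (i, q) d" for d
        using p by (cases d) (auto simp: sums)
      then have "ice_element ?h ?v (i, q) = ice_element h v (i, q)"
        by (simp add: ice_element_def ins_def outs_def)
      then show ?thesis
        using True unfolding p CM_of_UA_def C by simp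
    next
      case False
      then show ?thesis by (simp add: CM_of_UA_def C)
    qed
  qed
qed

lemma CM_statistics:
  assumes A: "A \<in> UA_set n"
  shows "ns_CM n (CM_of_UA n A) = neg_UA n A"
    and "ne_o_CM n (CM_of_UA n A) + se_e_CM n (CM_of_UA n A) = ssi_UA n A"
    and "wgt_e_CM n (CM_of_UA n A) = bar_UA n A"
proof -
  let ?C = "CM_of_UA n A"
  have fin: "finite {p \<in> positions n. P p}" for P
    using finite_positions by simp
  show "ns_CM n ?C = neg_UA n A"
    unfolding ns_CM_def neg_UA_def 
    by (rule arg_cong[where f = card]) (auto simp: CM_of_UA_eq[OF A] split: if_splits)
  have "ne_o_CM n ?C + se_e_CM n ?C
      = card ({p \<in> positions n. odd (fst p) \<and> ?C p = NE} \<union> {p \<in> positions n. even (fst p) \<and> ?C p = SE})"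
    unfolding ne_o_CM_def se_e_CM_def by (rule card_Un_disjoint[OF fin fin, symmetric]) auto
  also have "\<dots> = ssi_UA n A"
    unfolding ssi_UA_eq[OF A]
  proof (intro arg_cong[where f = card] Set.set_eqI)
    fix p :: "nat \<times> nat"
    obtain i q where p: "p = (i, q)" by (cases p)
    show "p \<in> {p \<in> positions n. odd (fst p) \<and> ?C p = NE} \<union> {p \<in> positions n. even (fst p) \<and> ?C p = SE} \<longleftrightarrow>
        p \<in> {(i, q). (i, q) \<in> positions n \<and> A (i, q) = 0 \<and> row_sum n A i q = 1 \<and>
          col_sum n A i q = (if odd i then 1 else 0)}"
    proof (cases "p \<in> positions n")
      case True
      have "A \<in> positions n \<rightarrow>\<^sub>E {- 1, 0, 1}" using A by (simp add: UA_set_def)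
      then have "A p \<in> {- 1, 0, 1}" using True by auto
      moreover have "col_sum n A i q \<in> {0, 1}"
        using True UA_col_sum[OF A] p by auto
      ultimately show ?thesis
        using True CM_of_UA_eq[OF A, of i q] unfolding p by auto
    qed (auto simp: p)
  qed
  finally show "ne_o_CM n ?C + se_e_CM n ?C = ssi_UA n A" .
  show "wgt_e_CM n ?C = bar_UA n A"
    unfolding bar_UA_eq[OF A] wgt_e_CM_def
  proof (intro arg_cong[where f = card] Set.set_eqI)
    fix p :: "nat \<times> nat"
    obtain i q where p: "p = (i, q)" by (cases p)
    show "p \<in> {p \<in> positions n. even (fst p) \<and> ?C p \<in> {NE, SE, WE}} \<longleftrightarrow>
        p \<in> {(i, q). (i, q) \<in> positions n \<and> even i \<and> row_sum n A i q = 1}"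
    proof (cases "p \<in> positions n")
      case True
      then have "row_sum n A i q \<in> {0, 1}" "row_sum n A i (Suc q) \<in> {0, 1}"
        using UA_row_sum[OF A] p by auto
      then show ?thesis
        using True CM_of_UA_eq[OF A, of i q] row_sum_step[of q n A i] unfolding p by auto
    qed (auto simp: p)
  qed
qed

lemma sum_UA_set_eq_sum_CM_set:
  fixes t :: "'b :: comm_ring_1"
  shows "(\<Sum>A\<in>UA_set n. t ^ (ssi_UA n A + bar_UA n A) * (1 + t) ^ neg_UA n A)
    = (\<Sum>C\<in>CM_set n. t ^ (ne_o_CM n C + se_e_CM n C + wgt_e_CM n C) * (1 + t) ^ ns_CM n C)"
  by (rule sum.reindex_bij_witness[of _ "UA_of_CM n" "CM_of_UA n"])
    (auto simp: UA_of_CM_of_UA CM_of_UA_in_CM_set UA_of_CM_in_UA_set CM_statistics)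

section \<open>From tableaux to U-turn matrices\<close>

definition strict_seq :: "nat \<Rightarrow> (nat \<Rightarrow> 'a :: linorder) \<Rightarrow> bool" where
  "strict_seq m x \<longleftrightarrow> (\<forall>i j. 1 \<le> i \<and> i < j \<and> j \<le> m \<longrightarrow> x i < x j)"

lemma strict_seqD: "strict_seq m x \<Longrightarrow> 1 \<le> i \<Longrightarrow> i < j \<Longrightarrow> j \<le> m \<Longrightarrow> x i < x j"
  by (simp add: strict_seq_def)

lemma strict_seq_Suc:
  assumes "\<And>i. 1 \<le> i \<Longrightarrow> Suc i \<le> m \<Longrightarrow> x i < x (Suc i)"
  shows "strict_seq m x"
proof -
  have "x i < x j" if "1 \<le> i" "i < j" "j \<le> m" for i j
    using that(2,3,1)
  proof (induction j rule: less_Suc_induct[of i j for j, consumes 1])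
    case (1 i)
    then show ?case using assms by simp
  next
    case (2 i j k)
    then show ?case by (meson Suc_le_eq less_imp_le order.strict_trans order.trans)
  qed
  then show ?thesis by (simp add: strict_seq_def)
qed

lemma strict_seq_inj: "strict_seq m x \<Longrightarrow> inj_on x {1..m}"
  unfolding inj_on_def strict_seq_def by (metis atLeastAtMost_iff less_irrefl linorder_neqE_nat)

definition count_le :: "'a :: linorder set \<Rightarrow> 'a \<Rightarrow> nat" where
  "count_le D c = card {y \<in> D. y \<le> c}"

text \<open>In a strictly increasing sequence the entries at most \<open>c\<close> form an initial
  segment.\<close>

lemma le_count_le_iff:
  assumes x: "strict_seq m x" and i: "1 \<le> i" "i \<le> m"
  shows "i \<le> count_le (x ` {1..m}) c \<longleftrightarrow> x i \<le> c"
proof -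
  let ?I = "{i \<in> {1..m}. x i \<le> c}"
  have "{y \<in> x ` {1..m}. y \<le> c} = x ` ?I" by auto
  moreover have "card (x ` ?I) = card ?I"
    by (rule card_image, rule inj_on_subset[OF strict_seq_inj[OF x]]) auto
  ultimately have eq: "count_le (x ` {1..m}) c = card ?I"
    by (simp add: count_le_def)
  show ?thesis
  proof (cases "x i \<le> c")
    case True
    have "x j \<le> c" if "j \<in> {1..i}" for j
      using strict_seqD[OF x, of j i] that True i by (cases "j = i") auto
    then have "{1..i} \<subseteq> ?I" using i by auto
    then have "card {1..i} \<le> card ?I" by (intro card_mono) auto
    then show ?thesis using True eq by simp
  next
    case False
    have "\<not> x j \<le> c" if "i \<le> j" "j \<le> m" for j
      using strict_seqD[OF x, of i j] that False i by (cases "j = i") auto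
    then have "?I \<subseteq> {1..<i}" by auto (meson not_le)
    then have "card ?I \<le> card {1..<i}" by (intro card_mono) auto
    then show ?thesis using False eq i by simp
  qed
qed

lemma count_le_bound: "count_le (x ` {1..m}) c \<le> m"
proof -
  have "count_le (x ` {1..m}) c \<le> card (x ` {1..m})"
    unfolding count_le_def by (intro card_mono) auto
  also have "\<dots> \<le> m" using card_image_le[of "{1..m}" x] by simp
  finally show ?thesis .
qed

text \<open>If \<open>y\<close> has \<open>k\<close> entries at most \<open>c\<close>, then
  \<open>x k \<le> y k \<le> c\<close> gives \<open>x\<close> at least as many; if \<open>x\<close>
  has \<open>Suc k\<close> of them, then \<open>y k \<le> x (Suc k) \<le> c\<close> gives
  \<open>y\<close> at least \<open>k\<close>.\<close>

lemma count_le_of_interlacing: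
  assumes x: "strict_seq (Suc m) x" and y: "strict_seq m y"
    and inter: "\<And>i. 1 \<le> i \<Longrightarrow> i \<le> m \<Longrightarrow> x i \<le> y i \<and> y i \<le> x (Suc i)"
  shows "int (count_le (x ` {1..Suc m}) c) - int (count_le (y ` {1..m}) c) \<in> {0, 1}"
proof -
  let ?X = "count_le (x ` {1..Suc m}) c" and ?Y = "count_le (y ` {1..m}) c"
  have bounds: "?X \<le> Suc m" "?Y \<le> m" by (rule count_le_bound)+
  have "?Y \<le> ?X"
  proof (cases "?Y = 0")
    case False
    then have "y ?Y \<le> c" using le_count_le_iff[OF y, of ?Y c] bounds by simp
    then have "x ?Y \<le> c" using inter[of ?Y] bounds False by auto
    then show ?thesis using le_count_le_iff[OF x, of ?Y c] bounds False by simp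
  qed simp
  moreover have "?X \<le> Suc ?Y"
  proof (cases "?X \<le> 1")
    case False
    then obtain k where k: "?X = Suc k" "1 \<le> k" "k \<le> m"
      using bounds by (cases ?X) auto
    then have "x (Suc k) \<le> c" using le_count_le_iff[OF x, of "Suc k" c] by simp
    then have "y k \<le> c" using inter[of k] k by auto
    then show ?thesis using le_count_le_iff[OF y, of k c] k by simp
  qed simp
  ultimately show ?thesis by auto
qed

text \<open>Testing the counts at \<open>c = y i\<close> gives the first inequality, and testing
  them at \<open>c = x (Suc i)\<close> gives the second.\<close>

lemma interlacing_of_count_le:
  assumes x: "strict_seq (Suc m) x" and y: "strict_seq m y"
    and "\<And>c. c \<in> x ` {1..Suc m} \<union> y ` {1..m} \<Longrightarrow>
      int (count_le (x ` {1..Suc m}) c) - int (count_le (y ` {1..m}) c) \<in> {0, 1}"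
    and i: "1 \<le> i" "i \<le> m"
  shows "x i \<le> y i" "y i \<le> x (Suc i)"
proof -
  have "i \<le> count_le (y ` {1..m}) (y i)"
    using le_count_le_iff[OF y i, of "y i"] by simp
  moreover have "y i \<in> x ` {1..Suc m} \<union> y ` {1..m}"
    using i by simp
  ultimately have "i \<le> count_le (x ` {1..Suc m}) (y i)"
    using assms(3)[of "y i"] by auto
  then show "x i \<le> y i"
    using le_count_le_iff[OF x, of i "y i"] i by simp
  have "Suc i \<le> count_le (x ` {1..Suc m}) (x (Suc i))"
    using le_count_le_iff[OF x, of "Suc i" "x (Suc i)"] i by simp
  moreover have "x (Suc i) \<in> x ` {1..Suc m} \<union> y ` {1..m}"
    using i by simp
  ultimately have "i \<le> count_le (y ` {1..m}) (x (Suc i))"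
    using assms(3)[of "x (Suc i)"] by auto
  then show "y i \<le> x (Suc i)"
    using le_count_le_iff[OF y i, of "x (Suc i)"] by simp
qed

definition nth_smallest :: "'a :: linorder set \<Rightarrow> nat \<Rightarrow> 'a" where
  "nth_smallest D i = sorted_list_of_set D ! (i - 1)"

lemma nth_smallest_image:
  assumes "strict_seq m x" "1 \<le> i" "i \<le> m"
  shows "nth_smallest (x ` {1..m}) i = x i"
proof -
  let ?l = "map x [1..<Suc m]"
  have "sorted_list_of_set (x ` {1..m}) = ?l"
  proof (rule sorted_list_of_set_unique[THEN iffD1], safe)
    show "sorted_wrt (<) ?l"
      using strict_seqD[OF assms(1)] by (auto simp: sorted_wrt_iff_nth_less simp del: upt_Suc)
    show "length ?l = card (x ` {1..m})"
      using strict_seq_inj[OF assms(1)] by (simp add: card_image del: upt_Suc)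
  qed (auto simp del: upt_Suc)
  then show ?thesis
    using assms by (simp add: nth_smallest_def del: upt_Suc)
qed

lemma strict_seq_nth_smallest:
  assumes "finite D"
  shows "strict_seq (card D) (nth_smallest D)" "nth_smallest D ` {1..card D} = D"
proof -
  have sorted: "sorted_wrt (<) (sorted_list_of_set D)"
    by simp
  show "strict_seq (card D) (nth_smallest D)"
    unfolding strict_seq_def nth_smallest_def
    using sorted by (auto simp: sorted_wrt_iff_nth_less)
  have "nth_smallest D ` {1..card D} = nth_smallest D ` Suc ` {0..<card D}"
    by (simp only: image_Suc_atLeastLessThan atLeastLessThanSuc_atLeastAtMost One_nat_def)
  also have "\<dots> = (!) (sorted_list_of_set D) ` {0..<card D}"
    by (simp only: image_image nth_smallest_def diff_Suc_1)
  also have "\<dots> = set (sorted_list_of_set D)"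
    using nth_image[of "card D" "sorted_list_of_set D"] by simp
  finally show "nth_smallest D ` {1..card D} = D"
    using assms by simp
qed


section \<open>Matrix rows as letters in decreasing order\<close>

definition letter_of_row :: "nat \<Rightarrow> nat \<Rightarrow> letter" where
  "letter_of_row n i = (if even i then Barred (Suc n - i div 2) else Unbarred (n - i div 2))"

definition row_of_letter :: "nat \<Rightarrow> letter \<Rightarrow> nat" where
  "row_of_letter n c = 2 * n + 2 - letter_code c"

lemma letter_code_letter_of_row: "i \<le> 2 * n \<Longrightarrow> letter_code (letter_of_row n i) = 2 * n + 2 - i"
  by (auto simp: letter_of_row_def elim!: evenE oddE)

lemma letters_iff_code: "c \<in> letters n \<longleftrightarrow> 2 \<le> letter_code c \<and> letter_code c \<le> 2 * n + 1"
  by (cases c) (auto simp: letters_def)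

lemma letter_of_row_in_letters: "1 \<le> i \<Longrightarrow> i \<le> 2 * n \<Longrightarrow> letter_of_row n i \<in> letters n"
  by (auto simp: letters_iff_code letter_code_letter_of_row)

lemma row_of_letter_bounds: "c \<in> letters n \<Longrightarrow> 1 \<le> row_of_letter n c \<and> row_of_letter n c \<le> 2 * n"
  by (auto simp: letters_iff_code row_of_letter_def)

lemma row_of_letter_of_row: "i \<le> 2 * n \<Longrightarrow> row_of_letter n (letter_of_row n i) = i"
  by (simp add: row_of_letter_def letter_code_letter_of_row)

lemma letter_of_row_of_letter: "c \<in> letters n \<Longrightarrow> letter_of_row n (row_of_letter n c) = c"
  by (auto simp: letters_iff_code row_of_letter_def letter_code_letter_of_row simp flip: letter_code_inject)

lemma letter_of_row_le_iff:
  "i \<le> 2 * n \<Longrightarrow> j \<le> 2 * n \<Longrightarrow> letter_of_row n i \<le> letter_of_row n j \<longleftrightarrow> j \<le> i"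
  by (auto simp: less_eq_letter_def letter_code_letter_of_row)

lemma is_barred_letter_of_row: "is_barred (letter_of_row n i) \<longleftrightarrow> even i"
  by (auto simp: letter_of_row_def)

text \<open>Lower rows carry smaller letters, so the rows from \<open>i\<close> downwards are the
  letters at most that of row \<open>i\<close>: column suffix sums become counting
  functions.\<close>

lemma sum_letters_eq_count_le:
  assumes D: "D \<subseteq> letters n" and i: "1 \<le> i" "i \<le> 2 * n"
  shows "(\<Sum>r=i..2 * n. of_bool (letter_of_row n r \<in> D)) = int (count_le D (letter_of_row n i))"
proof -
  have "bij_betw (letter_of_row n) {r \<in> {i..2 * n}. letter_of_row n r \<in> D} {y \<in> D. y \<le> letter_of_row n i}"
  proof (rule bij_betw_byWitness[where f' = "row_of_letter n"])
    show "row_of_letter n ` {y \<in> D. y \<le> letter_of_row n i} \<subseteq> {r \<in> {i..2 * n}. letter_of_row n r \<in> D}"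
    proof safe
      fix y assume y: "y \<in> D" "y \<le> letter_of_row n i"
      then have L: "y \<in> letters n" using D by auto
      show "letter_of_row n (row_of_letter n y) \<in> D"
        using y letter_of_row_of_letter[OF L] by simp
      have "letter_of_row n (row_of_letter n y) \<le> letter_of_row n i"
        using y letter_of_row_of_letter[OF L] by simp
      then show "row_of_letter n y \<in> {i..2 * n}"
        using row_of_letter_bounds[OF L] i letter_of_row_le_iff[of "row_of_letter n y" n i] by simp
    qed
  qed (use D i in \<open>auto simp: row_of_letter_of_row letter_of_row_of_letter letter_of_row_le_iff\<close>)
  then have "card {r \<in> {i..2 * n}. letter_of_row n r \<in> D} = count_le D (letter_of_row n i)"
    unfolding count_le_def by (rule bij_betw_same_card)
  moreover have "(\<Sum>r=i..2 * n. of_bool (letter_of_row n r \<in> D)) = int (card {r \<in> {i..2 * n}. letter_of_row n r \<in> D})"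
    by (simp add: of_bool_def sum.If_cases Int_def)
  ultimately show ?thesis by simp
qed

section \<open>Diagonals and row suffix sums\<close>

definition diag :: "nat \<Rightarrow> (box \<Rightarrow> letter) \<Rightarrow> nat \<Rightarrow> letter set" where
  "diag n T q = (\<lambda>i. T (i, i + q - 1)) ` {1..Suc n - q}"

text \<open>With differences of indicators of consecutive diagonals the row suffix sums telescope to
  the indicator of one diagonal, since diagonal \<open>n + 1\<close> is empty.\<close>

definition UA_of_ST :: "nat \<Rightarrow> (box \<Rightarrow> letter) \<Rightarrow> nat \<times> nat \<Rightarrow> int" where
  "UA_of_ST n T = restrict (\<lambda>(i, q). of_bool (letter_of_row n i \<in> diag n T q)
     - of_bool (letter_of_row n i \<in> diag n T (Suc q))) (positions n)"

definition row_support :: "nat \<Rightarrow> (nat \<times> nat \<Rightarrow> int) \<Rightarrow> nat \<Rightarrow> letter set" where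
  "row_support n A q = {c \<in> letters n. row_sum n A (row_of_letter n c) q = 1}"

definition ST_of_UA :: "nat \<Rightarrow> (nat \<times> nat \<Rightarrow> int) \<Rightarrow> box \<Rightarrow> letter" where
  "ST_of_UA n A = restrict (\<lambda>(i, j). nth_smallest (row_support n A (Suc j - i)) i) (SF n)"

lemma diag_empty: "n < q \<Longrightarrow> diag n T q = {}"
  by (simp add: diag_def)

lemma diag_subset_letters:
  assumes "T \<in> ST_set n" "1 \<le> q"
  shows "diag n T q \<subseteq> letters n"
  using assms by (auto simp: diag_def intro!: ST_letters)

lemma strict_seq_diag:
  assumes T: "T \<in> ST_set n" and q: "1 \<le> q"
  shows "strict_seq (Suc n - q) (\<lambda>i. T (i, i + q - 1))"
proof (rule strict_seq_Suc)
  fix i assume "1 \<le> i" "Suc i \<le> Suc n - q"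
  then show "T (i, i + q - 1) < T (Suc i, Suc i + q - 1)"
    using ST_diag_less[OF T, of i "i + q - 1"] q by simp
qed

lemma ST_interlacing:
  assumes T: "T \<in> ST_set n" and "1 \<le> q" "1 \<le> i" "i + q \<le> n"
  shows "T (i, i + q - 1) \<le> T (i, i + q)" "T (i, i + q) \<le> T (Suc i, i + q)"
proof -
  have "(i, i + q - 1) \<in> SF n" "i + q - 1 \<le> i + q" "(Suc i, i + q) \<in> SF n"
    using assms by auto
  then show "T (i, i + q - 1) \<le> T (i, i + q)" "T (i, i + q) \<le> T (Suc i, i + q)"
    using ST_row_mono[OF T, of i "i + q - 1" "i + q"] ST_col_mono[OF T, of i "Suc i" "i + q"] assms
    by auto
qed

lemma row_sum_UA_of_ST:
  assumes "1 \<le> i" "i \<le> 2 * n" "1 \<le> q" "q \<le> Suc n"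
  shows "row_sum n (UA_of_ST n T) i q = of_bool (letter_of_row n i \<in> diag n T q)"
  using assms(4,3)
proof (induction q rule: inc_induct)
  case base
  then show ?case by (simp add: diag_empty)
next
  case (step q)
  then show ?case using assms by (simp add: row_sum_step UA_of_ST_def)
qed

text \<open>The sets \<open>D q\<close> are arbitrary so that the formula serves both the diagonals
  of a tableau and the supports read off from a matrix.\<close>

lemma col_sum_eq_count_le:
  assumes "\<And>q. 1 \<le> q \<Longrightarrow> D q \<subseteq> letters n"
    and "\<And>i q. (i, q) \<in> positions n \<Longrightarrow>
      A (i, q) = of_bool (letter_of_row n i \<in> D q) - of_bool (letter_of_row n i \<in> D (Suc q))"
    and "1 \<le> i" "i \<le> 2 * n" "1 \<le> q" "q \<le> n"
  shows "col_sum n A i q = int (count_le (D q) (letter_of_row n i))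
    - int (count_le (D (Suc q)) (letter_of_row n i))"
proof -
  have "col_sum n A i q = (\<Sum>r=i..2 * n. of_bool (letter_of_row n r \<in> D q))
      - (\<Sum>r=i..2 * n. of_bool (letter_of_row n r \<in> D (Suc q)))"
    unfolding col_sum_def sum_subtractf[symmetric] using assms by (intro sum.cong) auto
  also have "(\<Sum>r=i..2 * n. of_bool (letter_of_row n r \<in> D q)) = int (count_le (D q) (letter_of_row n i))"
    using assms by (intro sum_letters_eq_count_le) auto
  also have "(\<Sum>r=i..2 * n. of_bool (letter_of_row n r \<in> D (Suc q)))
      = int (count_le (D (Suc q)) (letter_of_row n i))"
    using assms by (intro sum_letters_eq_count_le) auto
  finally show ?thesis .
qed

lemma col_sum_UA_of_ST:
  assumes "T \<in> ST_set n" "1 \<le> i" "i \<le> 2 * n" "1 \<le> q" "q \<le> n"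
  shows "col_sum n (UA_of_ST n T) i q = int (count_le (diag n T q) (letter_of_row n i))
    - int (count_le (diag n T (Suc q)) (letter_of_row n i))"
  by (rule col_sum_eq_count_le) (use assms in \<open>auto simp: UA_of_ST_def dest: diag_subset_letters\<close>)

lemma count_le_top:
  assumes "D \<subseteq> letters n" "1 \<le> n"
  shows "count_le D (letter_of_row n 1) = card D"
proof -
  have "{y \<in> D. y \<le> letter_of_row n 1} = D"
    using assms by (auto simp: less_eq_letter_def letter_code_letter_of_row letters_iff_code)
  then show ?thesis by (simp add: count_le_def)
qed

lemma card_diag:
  assumes "T \<in> ST_set n" "1 \<le> q"
  shows "card (diag n T q) = Suc n - q"
  using strict_seq_inj[OF strict_seq_diag[OF assms]] by (simp add: diag_def card_image)

text \<open>A U-turn joins the rows of the two letters with a common index, so the U-turn condition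
  speaks about one box of the main diagonal.\<close>

lemma letter_of_row_pair:
  assumes "1 \<le> i" "i \<le> n"
  shows "letter_of_row n (2 * i - 1) = Unbarred (Suc n - i)" "letter_of_row n (2 * i) = Barred (Suc n - i)"
  using assms by (auto simp: letter_code_letter_of_row simp flip: letter_code_inject)

lemma ST_main_diagonal:
  assumes "T \<in> ST_set n" "1 \<le> i" "i \<le> n"
  shows "T (i, i) = Unbarred i \<or> T (i, i) = Barred i"
  using assms by (auto simp: ST_set_def)

text \<open>Row sums are indicators. Column sums are differences of counting functions of
  interlacing diagonals; over a full column they give the difference of the diagonal lengths, which
  is 1.\<close>

lemma UA_of_ST_in_UA_set:
  assumes T: "T \<in> ST_set n"
  shows "UA_of_ST n T \<in> UA_set n"
proof -
  have "row_sum n (UA_of_ST n T) (2 * i - 1) 1 + row_sum n (UA_of_ST n T) (2 * i) 1 = 1"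
    if i: "1 \<le> i" "i \<le> n" for i
  proof -
    define k where "k = Suc n - i"
    have k: "1 \<le> k" "k \<le> n" using i by (auto simp: k_def)
    \<comment> \<open>The main diagonal box of row \<open>r\<close> carries a letter of index
      \<open>r\<close>, so a letter of index \<open>k\<close> can only stand in row
      \<open>k\<close>.\<close>
    have mem: "c \<in> diag n T 1 \<longleftrightarrow> T (k, k) = c" if "c = Unbarred k \<or> c = Barred k" for c
    proof
      assume "c \<in> diag n T 1"
      then obtain r where "1 \<le> r" "r \<le> n" "T (r, r) = c" by (auto simp: diag_def)
      then show "T (k, k) = c" using ST_main_diagonal[OF T, of r] that by auto
    qed (use k in \<open>auto simp: diag_def\<close>)
    have "row_sum n (UA_of_ST n T) (2 * i - 1) 1 = of_bool (T (k, k) = Unbarred k)"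
      "row_sum n (UA_of_ST n T) (2 * i) 1 = of_bool (T (k, k) = Barred k)"
      using row_sum_UA_of_ST[of "2 * i - 1" n 1 T] row_sum_UA_of_ST[of "2 * i" n 1 T] i
        letter_of_row_pair[OF i] mem[of "Unbarred k"] mem[of "Barred k"] k_def by simp_all
    then show ?thesis
      using ST_main_diagonal[OF T k] by auto
  qed
  moreover have "col_sum n (UA_of_ST n T) i q \<in> {0, 1}"
    if i: "1 \<le> i" "i \<le> 2 * n" and q: "1 \<le> q" "q \<le> n" for i q
  proof -
    define m where "m = n - q"
    have m: "Suc n - q = Suc m" "Suc n - Suc q = m" using q by (auto simp: m_def)
    have "int (count_le (diag n T q) (letter_of_row n i)) - int (count_le (diag n T (Suc q)) (letter_of_row n i)) \<in> {0, 1}"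
      unfolding diag_def m
    proof (rule count_le_of_interlacing)
      show "strict_seq (Suc m) (\<lambda>i. T (i, i + q - 1))" "strict_seq m (\<lambda>i. T (i, i + Suc q - 1))"
        using strict_seq_diag[OF T, of q] strict_seq_diag[OF T, of "Suc q"] q m by auto
      fix r assume "1 \<le> r" "r \<le> m"
      then show "T (r, r + q - 1) \<le> T (r, r + Suc q - 1) \<and> T (r, r + Suc q - 1) \<le> T (Suc r, Suc r + q - 1)"
        using ST_interlacing[OF T, of q r] q by (simp add: m_def)
    qed
    then show ?thesis using T i q by (simp add: col_sum_UA_of_ST)
  qed
  moreover have "col_sum n (UA_of_ST n T) 1 q = 1" if q: "1 \<le> q" "q \<le> n" for q
  proof -
    have "diag n T q \<subseteq> letters n" "diag n T (Suc q) \<subseteq> letters n"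
      using q diag_subset_letters[OF T] by auto
    then show ?thesis
      using q by (simp add: col_sum_UA_of_ST[OF T] count_le_top card_diag[OF T] del: One_nat_def)
  qed
  moreover have "row_sum n (UA_of_ST n T) i q \<in> {0, 1}"
    if "1 \<le> i" "i \<le> 2 * n" "1 \<le> q" "q \<le> n" for i q
    using that by (simp add: row_sum_UA_of_ST)
  moreover have "UA_of_ST n T \<in> extensional (positions n)"
    by (simp add: UA_of_ST_def)
  ultimately show ?thesis
    unfolding mem_UA_set by blast
qed

text \<open>The support in column \<open>q\<close> is the set of letters on diagonal
  \<open>q\<close>; as diagonals strictly increase, sorting that set restores the boxes.\<close>

lemma ST_of_UA_of_ST:
  assumes T: "T \<in> ST_set n"
  shows "ST_of_UA n (UA_of_ST n T) = T"
proof -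
  have supp: "row_support n (UA_of_ST n T) q = diag n T q" if "1 \<le> q" "q \<le> n" for q
    using that diag_subset_letters[OF T, of q] row_of_letter_bounds
    by (auto simp: row_support_def row_sum_UA_of_ST letter_of_row_of_letter)
  show ?thesis
  proof
    fix b
    show "ST_of_UA n (UA_of_ST n T) b = T b"
    proof (cases "b \<in> SF n")
      case True
      then obtain i j where b: "b = (i, j)" "1 \<le> i" "i \<le> j" "j \<le> n" by (cases b) auto
      then have q: "1 \<le> Suc j - i" "Suc j - i \<le> n" "i \<le> Suc n - (Suc j - i)" by auto
      have "ST_of_UA n (UA_of_ST n T) b = nth_smallest (diag n T (Suc j - i)) i"
        using True b q by (simp add: ST_of_UA_def supp)
      also have "\<dots> = T (i, i + (Suc j - i) - 1)"
        unfolding diag_def by (rule nth_smallest_image[OF strict_seq_diag[OF T q(1)] b(2) q(3)])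
      finally show ?thesis using b by simp
    next
      case False
      then show ?thesis
        using T by (cases b) (auto simp: ST_of_UA_def ST_set_def PiE_def extensional_def)
    qed
  qed
qed

section \<open>From U-turn matrices to tableaux\<close>

lemma row_support_Suc_n: "row_support n A (Suc n) = {}"
  by (simp add: row_support_def)

lemma row_support_subset: "row_support n A q \<subseteq> letters n"
  by (simp add: row_support_def)

lemma mem_row_support:
  assumes "A \<in> UA_set n" "1 \<le> i" "i \<le> 2 * n" "1 \<le> q" "q \<le> Suc n"
  shows "of_bool (letter_of_row n i \<in> row_support n A q) = row_sum n A i q"
  using UA_row_sum[OF assms] assms
  by (auto simp: row_support_def letter_of_row_in_letters row_of_letter_of_row)

lemma UA_eq_row_support:
  assumes A: "A \<in> UA_set n" and p: "(i, q) \<in> positions n"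
  shows "A (i, q) = of_bool (letter_of_row n i \<in> row_support n A q)
    - of_bool (letter_of_row n i \<in> row_support n A (Suc q))"
  using p by (simp add: mem_row_support[OF A] row_sum_step)

lemma col_sum_row_support:
  assumes A: "A \<in> UA_set n" and "1 \<le> i" "i \<le> 2 * n" "1 \<le> q" "q \<le> n"
  shows "col_sum n A i q = int (count_le (row_support n A q) (letter_of_row n i))
    - int (count_le (row_support n A (Suc q)) (letter_of_row n i))"
  by (rule col_sum_eq_count_le[OF row_support_subset UA_eq_row_support[OF A] assms(2-5)])

lemma finite_row_support: "finite (row_support n A q)"
  by (rule finite_subset[OF row_support_subset finite_letters])

text \<open>Full column sums equal to 1 make each support one letter larger than the next, down to
  the empty one at \<open>n + 1\<close>.\<close>

lemma card_row_support:
  assumes A: "A \<in> UA_set n" and "1 \<le> q" "q \<le> Suc n"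
  shows "card (row_support n A q) = Suc n - q"
  using assms(3,2)
proof (induction q rule: inc_induct)
  case base
  then show ?case by (simp add: row_support_Suc_n)
next
  case (step q)
  have "col_sum n A 1 q = 1"
    using A step by (simp add: mem_UA_set)
  then have "int (card (row_support n A q)) - int (card (row_support n A (Suc q))) = 1"
    using col_sum_row_support[OF A, of 1 q] step by (simp add: count_le_top row_support_subset del: One_nat_def)
  then show ?case using step by simp
qed

lemma strict_seq_row_support:
  assumes A: "A \<in> UA_set n" and q: "1 \<le> q" "q \<le> Suc n"
  shows "strict_seq (Suc n - q) (nth_smallest (row_support n A q))"
    and "nth_smallest (row_support n A q) ` {1..Suc n - q} = row_support n A q"
  using strict_seq_nth_smallest[OF finite_row_support[of n A q]] unfolding card_row_support[OF assms] by auto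

text \<open>Every letter belongs to some row, so the column sum condition there bounds the
  difference of the counting functions at that letter, and this is interlacing.\<close>

lemma nth_smallest_row_support_interlacing:
  assumes A: "A \<in> UA_set n" and q: "1 \<le> q" and i: "1 \<le> i" "i + q \<le> n"
  shows "nth_smallest (row_support n A q) i \<le> nth_smallest (row_support n A (Suc q)) i"
    and "nth_smallest (row_support n A (Suc q)) i \<le> nth_smallest (row_support n A q) (Suc i)"
proof -
  define m where "m = n - q"
  have m: "Suc n - q = Suc m" "Suc n - Suc q = m" "1 \<le> i" "i \<le> m" "q \<le> n"
    using q i by (auto simp: m_def)
  let ?x = "nth_smallest (row_support n A q)" and ?y = "nth_smallest (row_support n A (Suc q))"
  have x: "strict_seq (Suc m) ?x" "?x ` {1..Suc m} = row_support n A q"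
    using strict_seq_row_support[OF A q, unfolded m] m by auto
  have y: "strict_seq m ?y" "?y ` {1..m} = row_support n A (Suc q)"
    using strict_seq_row_support[OF A, of "Suc q", unfolded m] m q by auto
  have c: "int (count_le (?x ` {1..Suc m}) c) - int (count_le (?y ` {1..m}) c) \<in> {0, 1}"
    if "c \<in> ?x ` {1..Suc m} \<union> ?y ` {1..m}" for c
  proof -
    have "c \<in> letters n"
      using that row_support_subset unfolding x y by blast
    then have r: "1 \<le> row_of_letter n c" "row_of_letter n c \<le> 2 * n" "letter_of_row n (row_of_letter n c) = c"
      using row_of_letter_bounds letter_of_row_of_letter by auto
    show ?thesis
      unfolding x y using col_sum_row_support[OF A r(1,2) q m(5)] UA_col_sum[OF A r(1) _ q m(5)] r by simp
  qed
  show "?x i \<le> ?y i" "?y i \<le> ?x (Suc i)"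
    using interlacing_of_count_le[OF x(1) y(1) c m(3,4)] by auto
qed

lemma nth_smallest_row_support_1:
  assumes A: "A \<in> UA_set n" and i: "1 \<le> i" "i \<le> n"
  shows "nth_smallest (row_support n A 1) i \<in> {Unbarred i, Barred i}"
proof -
  let ?D = "row_support n A 1"
  have one: "of_bool (Unbarred k \<in> ?D) + of_bool (Barred k \<in> ?D) = (1 :: int)" if k: "1 \<le> k" "k \<le> n" for k
  proof -
    have k': "1 \<le> Suc n - k" "Suc n - k \<le> n" "Suc n - (Suc n - k) = k"
      using k by auto
    have "row_sum n A (2 * (Suc n - k) - 1) 1 + row_sum n A (2 * (Suc n - k)) 1 = 1"
      using A k' by (simp add: mem_UA_set)
    then show ?thesis
      using mem_row_support[OF A, of "2 * (Suc n - k) - 1" 1] mem_row_support[OF A, of "2 * (Suc n - k)" 1]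
        letter_of_row_pair[OF k'(1,2)] k k' by simp
  qed
  \<comment> \<open>By \<open>one\<close>, exactly one letter of each index lies in the support;
    listed by index these are already increasing, so the \<open>i\<close>-th smallest has index
    \<open>i\<close>.\<close>
  define d where "d k = (if Barred k \<in> ?D then Barred k else Unbarred k)" for k
  have "strict_seq n d"
    by (rule strict_seq_Suc) (auto simp: d_def less_letter_def)
  moreover have "d ` {1..n} = ?D"
  proof
    show "d ` {1..n} \<subseteq> ?D"
      using one by (auto simp: d_def split: if_splits) fastforce
    show "?D \<subseteq> d ` {1..n}"
    proof
      fix c assume c: "c \<in> ?D"
      then obtain k where k: "1 \<le> k" "k \<le> n" "c = Unbarred k \<or> c = Barred k"
        using row_support_subset[of n A 1] by (auto simp: letters_def)
      then have "c = d k"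
        using one[of k] c by (auto simp: d_def split: if_splits)
      then show "c \<in> d ` {1..n}" using k by auto
    qed
  qed
  ultimately have "nth_smallest ?D i = d i"
    using nth_smallest_image[of n d i] i by simp
  then show ?thesis by (simp add: d_def)
qed

lemma ST_of_UA_in_ST_set:
  assumes A: "A \<in> UA_set n"
  shows "ST_of_UA n A \<in> ST_set n"
proof -
  let ?T = "ST_of_UA n A" and ?D = "row_support n A"
  have val: "?T (i, j) = nth_smallest (?D (Suc j - i)) i" if "1 \<le> i" "i \<le> j" "j \<le> n" for i j
    using that by (simp add: ST_of_UA_def)
  have "?T (i, j) \<in> letters n" if ij: "1 \<le> i" "i \<le> j" "j \<le> n" for i j
  proof -
    have "nth_smallest (?D (Suc j - i)) i \<in> ?D (Suc j - i)"
      using strict_seq_row_support(2)[OF A, of "Suc j - i"] ij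
        imageI[of i "{1..Suc n - (Suc j - i)}" "nth_smallest (?D (Suc j - i))"] by auto
    then show ?thesis using row_support_subset val[OF ij] by auto
  qed
  moreover have "?T (i, j) \<le> ?T (i, Suc j)" if "1 \<le> i" "i \<le> j" "j < n" for i j
    using nth_smallest_row_support_interlacing(1)[OF A, of "Suc j - i" i] that by (simp add: val Suc_diff_le)
  moreover have "?T (i, j) \<le> ?T (Suc i, j)" if "1 \<le> i" "i < j" "j \<le> n" for i j
    using nth_smallest_row_support_interlacing(2)[OF A, of "j - i" i] that by (simp add: val Suc_diff_le)
  moreover have "?T (i, j) < ?T (Suc i, Suc j)" if "1 \<le> i" "i \<le> j" "j < n" for i j
    using strict_seqD[OF strict_seq_row_support(1)[OF A, of "Suc j - i"], of i "Suc i"] that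
    by (simp add: val Suc_diff_le)
  moreover have "?T (i, i) \<in> {Unbarred i, Barred i}" if "1 \<le> i" "i \<le> n" for i
    using nth_smallest_row_support_1[OF A that] that by (simp add: val)
  moreover have "?T \<in> extensional (SF n)"
    by (simp add: ST_of_UA_def)
  ultimately show ?thesis
    by (auto simp: ST_set_def PiE_def)
qed

lemma UA_of_ST_of_UA:
  assumes A: "A \<in> UA_set n"
  shows "UA_of_ST n (ST_of_UA n A) = A"
proof -
  have diag: "diag n (ST_of_UA n A) q = row_support n A q" if q: "1 \<le> q" "q \<le> Suc n" for q
  proof -
    have "diag n (ST_of_UA n A) q = nth_smallest (row_support n A q) ` {1..Suc n - q}"
      unfolding diag_def using q by (intro image_cong) (auto simp: ST_of_UA_def)
    then show ?thesis using strict_seq_row_support(2)[OF A q] by simp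
  qed
  show ?thesis
  proof
    fix p
    show "UA_of_ST n (ST_of_UA n A) p = A p"
    proof (cases "p \<in> positions n")
      case True
      then obtain i q where p: "p = (i, q)" "(i, q) \<in> positions n" by (cases p) auto
      then show ?thesis
        using UA_eq_row_support[OF A p(2)] by (simp add: UA_of_ST_def diag)
    next
      case False
      then show ?thesis
        using A by (cases p) (auto simp: UA_of_ST_def mem_UA_set extensional_def)
    qed
  qed
qed

section \<open>Transfer of the statistics\<close>

lemma bij_boxes:
  assumes T: "T \<in> ST_set n"
  shows "bij_betw (\<lambda>(r, s). (row_of_letter n (T (r, s)), Suc s - r - d)) {(r, s). (r, s) \<in> SF n \<and> r + d \<le> s}
    {(i, q). (i, q) \<in> positions n \<and> letter_of_row n i \<in> diag n T (q + d)}"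
    (is "bij_betw ?f ?X ?Y")
  unfolding bij_betw_def
proof
  show "inj_on ?f ?X"
  proof (rule inj_onI, clarify)
    fix r s r' s'
    assume b: "(r, s) \<in> SF n" "r + d \<le> s" "(r', s') \<in> SF n" "r' + d \<le> s'"
      and eq: "row_of_letter n (T (r, s)) = row_of_letter n (T (r', s'))" "Suc s - r - d = Suc s' - r' - d"
    have T': "T (r, s) = T (r', s')"
      using eq(1) letter_of_row_of_letter ST_letters[OF T] b by metis
    \<comment> \<open>A letter occurs at most once on a diagonal, so letter and diagonal together
      identify the box.\<close>
    have less: "T (r, s) < T (r', s')" if "r < r'" "1 \<le> r" "r \<le> s" "s' \<le> n" "s' - r' = s - r" "r' \<le> s'" for r r' s s'
    proof -
      define q where "q = Suc s - r"
      have "1 \<le> q" "s = r + q - 1" "s' = r' + q - 1" "r' \<le> Suc n - q"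
        using that by (auto simp: q_def)
      then show ?thesis
        using strict_seqD[OF strict_seq_diag[OF T, of q], of r r'] that by auto
    qed
    have "s' - r' = s - r"
      using b(2,4) eq(2) by arith
    then have "r = r'"
      using less[of r r' s s'] less[of r' r s' s] T' b eq(2) by (cases r r' rule: linorder_cases) auto
    then show "r = r' \<and> s = s'" using eq(2) b by auto
  qed
  show "?f ` ?X = ?Y"
  proof (intro equalityI subsetI)
    fix p assume "p \<in> ?f ` ?X"
    then obtain r s where rs: "(r, s) \<in> SF n" "r + d \<le> s" "p = ?f (r, s)" by auto
    have L: "T (r, s) \<in> letters n" using ST_letters[OF T rs(1)] .
    have "T (r, s) = T (r, r + (Suc s - r - d + d) - 1)" "r \<in> {1..Suc n - (Suc s - r - d + d)}"
      using rs by auto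
    then have "T (r, s) \<in> diag n T (Suc s - r - d + d)"
      unfolding diag_def by blast
    then show "p \<in> ?Y"
      using rs row_of_letter_bounds[OF L] letter_of_row_of_letter[OF L] by auto
  next
    fix p assume "p \<in> ?Y"
    then obtain i q where iq: "p = (i, q)" "(i, q) \<in> positions n" "letter_of_row n i \<in> diag n T (q + d)"
      by auto
    then obtain r where r: "1 \<le> r" "r \<le> Suc n - (q + d)" "letter_of_row n i = T (r, r + (q + d) - 1)"
      by (auto simp: diag_def)
    have "p = ?f (r, r + (q + d) - 1)"
      using iq r row_of_letter_of_row[of i n] by (auto simp flip: r(3))
    moreover have "(r, r + (q + d) - 1) \<in> ?X"
      using iq r by auto
    ultimately show "p \<in> ?f ` ?X" by blast
  qed
qed

text \<open>The shift \<open>d\<close> selects the matrix column that a box is recorded in: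
  \<open>d = 0\<close> uses its own diagonal and serves \<open>bar_UA\<close>; \<open>d = 1\<close>
  uses the preceding, longer diagonal and serves \<open>neg_UA\<close> and
  \<open>ssi_UA\<close>.\<close>

lemma card_boxes_eq:
  assumes T: "T \<in> ST_set n"
  shows "card {(r, s). (r, s) \<in> SF n \<and> r + d \<le> s \<and> P (row_of_letter n (T (r, s)), Suc s - r - d)}
    = card {(i, q). (i, q) \<in> positions n \<and> letter_of_row n i \<in> diag n T (q + d) \<and> P (i, q)}"
proof -
  let ?f = "\<lambda>(r, s). (row_of_letter n (T (r, s)), Suc s - r - d)"
  let ?X = "{(r, s). (r, s) \<in> SF n \<and> r + d \<le> s \<and> P (row_of_letter n (T (r, s)), Suc s - r - d)}"
  let ?Y = "{(i, q). (i, q) \<in> positions n \<and> letter_of_row n i \<in> diag n T (q + d) \<and> P (i, q)}"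
  note bij = bij_boxes[OF T, of d]
  have "inj_on ?f ?X"
    by (rule inj_on_subset[OF bij_betw_imp_inj_on[OF bij]]) auto
  moreover have "?f ` ?X = ?Y"
  proof -
    have "?f ` ?X = {p \<in> ?f ` {(r, s). (r, s) \<in> SF n \<and> r + d \<le> s}. P p}"
      by auto
    also have "\<dots> = ?Y"
      unfolding bij_betw_imp_surj_on[OF bij] by auto
    finally show ?thesis .
  qed
  ultimately show ?thesis
    using card_image[of ?f ?X] by simp
qed

text \<open>The entry lies weakly between its left neighbour and the letter below, which are
  consecutive on the preceding diagonal. That diagonal strictly increases, so only these two can
  equal the entry.\<close>

lemma mem_diag_iff:
  assumes T: "T \<in> ST_set n" and b: "(r, s) \<in> SF n" "r < s"
  shows "T (r, s) \<in> diag n T (s - r) \<longleftrightarrow> left_eq T (r, s) \<or> below_eq T (r, s)"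
proof -
  let ?x = "\<lambda>i. T (i, i + (s - r) - 1)"
  have q: "1 \<le> s - r" and rs: "1 \<le> r" "Suc r \<le> Suc n - (s - r)" using b by auto
  have ends: "?x r = T (r, s - 1)" "?x (Suc r) = T (Suc r, s)" using b by auto
  have inter: "?x r \<le> T (r, s)" "T (r, s) \<le> ?x (Suc r)"
    using ST_interlacing[OF T q, of r] b unfolding ends by auto
  have strict: "strict_seq (Suc n - (s - r)) ?x"
    by (rule strict_seq_diag[OF T q])
  have "T (r, s) \<in> diag n T (s - r) \<longleftrightarrow> ?x r = T (r, s) \<or> ?x (Suc r) = T (r, s)"
  proof
    assume "T (r, s) \<in> diag n T (s - r)"
    then obtain i where i: "1 \<le> i" "i \<le> Suc n - (s - r)" "T (r, s) = ?x i"
      by (auto simp: diag_def)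
    have "\<not> i < r" using strict_seqD[OF strict, of i r] i inter rs by auto
    moreover have "\<not> Suc r < i" using strict_seqD[OF strict, of "Suc r" i] i inter rs by auto
    ultimately have "i = r \<or> i = Suc r" by auto
    then show "?x r = T (r, s) \<or> ?x (Suc r) = T (r, s)" using i by auto
  next
    have mem: "?x i \<in> diag n T (s - r)" if "1 \<le> i" "i \<le> Suc n - (s - r)" for i
      using that by (auto simp: diag_def)
    have "?x r \<in> diag n T (s - r)" "?x (Suc r) \<in> diag n T (s - r)"
      using rs by (intro mem; simp)+
    moreover assume "?x r = T (r, s) \<or> ?x (Suc r) = T (r, s)"
    ultimately show "T (r, s) \<in> diag n T (s - r)" by metis
  qed
  then show ?thesis
    using b unfolding ends by (simp add: left_eq_def below_eq_def)
qed

text \<open>The letter is the \<open>r\<close>-th on its own diagonal. On the preceding one it is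
  the \<open>r\<close>-th if it repeats the left neighbour and the \<open>Suc r\<close>-th if it
  repeats the letter below; the column sum is the difference of these ranks.\<close>

lemma col_sum_at_box:
  assumes T: "T \<in> ST_set n" and b: "(r, s) \<in> SF n" "r < s" and "left_eq T (r, s) \<or> below_eq T (r, s)"
  shows "col_sum n (UA_of_ST n T) (row_of_letter n (T (r, s))) (s - r) = (if left_eq T (r, s) then 0 else 1)"
proof -
  let ?c = "T (r, s)" and ?q = "s - r"
  let ?x = "\<lambda>i. T (i, i + ?q - 1)" and ?y = "\<lambda>i. T (i, i + Suc ?q - 1)"
  have L: "?c \<in> letters n" using ST_letters[OF T b(1)] .
  have q: "1 \<le> ?q" "?q \<le> n" using b by auto
  have x: "strict_seq (Suc n - ?q) ?x" and y: "strict_seq (Suc n - Suc ?q) ?y"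
    using strict_seq_diag[OF T q(1)] strict_seq_diag[OF T, of "Suc ?q"] by auto
  have count: "count_le (z ` {1..m}) c = k"
    if "strict_seq m z" "1 \<le> k" "k \<le> m" "z k = c" for m z k and c :: letter
  proof -
    have "k \<le> count_le (z ` {1..m}) c"
      using le_count_le_iff[OF that(1-3)] that by simp
    moreover have "\<not> Suc k \<le> count_le (z ` {1..m}) c"
    proof
      assume *: "Suc k \<le> count_le (z ` {1..m}) c"
      then have "Suc k \<le> m" using count_le_bound[of z m c] by simp
      then show False
        using * le_count_le_iff[OF that(1), of "Suc k" c] strict_seqD[OF that(1), of k "Suc k"] that by auto
    qed
    ultimately show ?thesis by simp
  qed
  have "count_le (diag n T (Suc ?q)) ?c = r"
    unfolding diag_def by (rule count[OF y]) (use b in auto)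
  moreover have "count_le (diag n T ?q) ?c = (if left_eq T (r, s) then r else Suc r)"
  proof (cases "left_eq T (r, s)")
    case True
    have "count_le (diag n T ?q) ?c = r"
      unfolding diag_def by (rule count[OF x]) (use b True in \<open>auto simp: left_eq_def\<close>)
    then show ?thesis using True by simp
  next
    case False
    then have B: "below_eq T (r, s)" using assms(4) by simp
    have "count_le (diag n T ?q) ?c = Suc r"
      unfolding diag_def by (rule count[OF x]) (use b B in \<open>auto simp: below_eq_def\<close>)
    then show ?thesis using False by simp
  qed
  ultimately show ?thesis
    using col_sum_UA_of_ST[OF T _ _ q, of "row_of_letter n ?c"] row_of_letter_bounds[OF L]
      letter_of_row_of_letter[OF L] by simp
qed

text \<open>Entries -1 mark letters absent from the preceding diagonal, that is, off-diagonal ribbon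
  ends. Positive zeros mark letters on both diagonals, where the column sum tells left from below;
  even rows are the barred letters, so the parity condition of \<open>ssi_UA\<close> is the one in
  \<open>var_ST\<close>.\<close>

lemma UA_statistics:
  assumes T: "T \<in> ST_set n"
  shows "neg_UA n (UA_of_ST n T) = str_ST n T - n"
    and "bar_UA n (UA_of_ST n T) = bar_ST n T"
    and "ssi_UA n (UA_of_ST n T) = var_ST n T"
proof -
  let ?A = "UA_of_ST n T" and ?l = "letter_of_row n" and ?row = "\<lambda>b. row_of_letter n (T b)"
  have A: "?A \<in> UA_set n" by (rule UA_of_ST_in_UA_set[OF T])
  have letter: "?l (?row b) = T b" if "b \<in> SF n" for b
    by (rule letter_of_row_of_letter[OF ST_letters[OF T that]])
  have val: "?A (i, q) = of_bool (?l i \<in> diag n T q) - of_bool (?l i \<in> diag n T (Suc q))"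
    if "(i, q) \<in> positions n" for i q
    using that by (simp add: UA_of_ST_def)
  have row: "row_sum n ?A i q = of_bool (?l i \<in> diag n T q)" if "(i, q) \<in> positions n" for i q
    using that by (simp add: row_sum_UA_of_ST)
  have "neg_UA n ?A = card {(i, q). (i, q) \<in> positions n \<and> ?l i \<in> diag n T (q + 1) \<and>
      (\<lambda>(i, q). ?l i \<notin> diag n T q) (i, q)}"
    unfolding neg_UA_def
  proof (intro arg_cong[where f = card] Set.set_eqI)
    fix p :: "nat \<times> nat"
    obtain i q where p: "p = (i, q)" by (cases p)
    show "p \<in> {p \<in> positions n. ?A p = - 1} \<longleftrightarrow> p \<in> {(i, q). (i, q) \<in> positions n \<and>
        ?l i \<in> diag n T (q + 1) \<and> (\<lambda>(i, q). ?l i \<notin> diag n T q) (i, q)}"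
      using val[of i q] unfolding p by (auto simp: of_bool_def split: if_splits)
  qed
  also have "\<dots> = card {(r, s). (r, s) \<in> SF n \<and> r + 1 \<le> s \<and>
      (\<lambda>(i, q). ?l i \<notin> diag n T q) (?row (r, s), Suc s - r - 1)}"
    by (rule card_boxes_eq[OF T, symmetric])
  also have "\<dots> = card {b \<in> SF n. fst b < snd b \<and> \<not> left_eq T b \<and> \<not> below_eq T b}"
  proof (intro arg_cong[where f = card] Set.set_eqI)
    fix b :: box
    obtain r s where b: "b = (r, s)" by (cases b)
    show "b \<in> {(r, s). (r, s) \<in> SF n \<and> r + 1 \<le> s \<and>
        (\<lambda>(i, q). ?l i \<notin> diag n T q) (?row (r, s), Suc s - r - 1)} \<longleftrightarrow>
        b \<in> {b \<in> SF n. fst b < snd b \<and> \<not> left_eq T b \<and> \<not> below_eq T b}"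
      using mem_diag_iff[OF T, of r s] letter[of "(r, s)"] unfolding b by auto
  qed
  finally show "neg_UA n ?A = str_ST n T - n"
    using str_ST_eq[OF T] by simp
  have "bar_UA n ?A = card {(i, q). (i, q) \<in> positions n \<and> ?l i \<in> diag n T (q + 0) \<and>
      (\<lambda>(i, q). even i) (i, q)}"
    unfolding bar_UA_eq[OF A]
  proof (intro arg_cong[where f = card] Set.set_eqI)
    fix p :: "nat \<times> nat"
    obtain i q where p: "p = (i, q)" by (cases p)
    show "p \<in> {(i, q). (i, q) \<in> positions n \<and> even i \<and> row_sum n ?A i q = 1} \<longleftrightarrow>
        p \<in> {(i, q). (i, q) \<in> positions n \<and> ?l i \<in> diag n T (q + 0) \<and> (\<lambda>(i, q). even i) (i, q)}"
      using row[of i q] unfolding p by auto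
  qed
  also have "\<dots> = card {(r, s). (r, s) \<in> SF n \<and> r + 0 \<le> s \<and>
      (\<lambda>(i, q). even i) (?row (r, s), Suc s - r - 0)}"
    by (rule card_boxes_eq[OF T, symmetric])
  also have "\<dots> = bar_ST n T"
    unfolding bar_ST_def
  proof (intro arg_cong[where f = card] Set.set_eqI)
    fix b :: box
    obtain r s where b: "b = (r, s)" by (cases b)
    show "b \<in> {(r, s). (r, s) \<in> SF n \<and> r + 0 \<le> s \<and>
        (\<lambda>(i, q). even i) (?row (r, s), Suc s - r - 0)} \<longleftrightarrow> b \<in> {b \<in> SF n. is_barred (T b)}"
      using is_barred_letter_of_row[of n "?row (r, s)"] letter[of "(r, s)"] unfolding b by auto
  qed
  finally show "bar_UA n ?A = bar_ST n T" .
  let ?P = "\<lambda>(i, q). ?l i \<in> diag n T q \<and> col_sum n ?A i q = (if odd i then 1 else 0)"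
  have "ssi_UA n ?A = card {(i, q). (i, q) \<in> positions n \<and> ?l i \<in> diag n T (q + 1) \<and> ?P (i, q)}"
    unfolding ssi_UA_eq[OF A]
  proof (intro arg_cong[where f = card] Set.set_eqI)
    fix p :: "nat \<times> nat"
    obtain i q where p: "p = (i, q)" by (cases p)
    show "p \<in> {(i, q). (i, q) \<in> positions n \<and> ?A (i, q) = 0 \<and> row_sum n ?A i q = 1 \<and>
          col_sum n ?A i q = (if odd i then 1 else 0)} \<longleftrightarrow>
        p \<in> {(i, q). (i, q) \<in> positions n \<and> ?l i \<in> diag n T (q + 1) \<and> ?P (i, q)}"
      using val[of i q] row[of i q] unfolding p by auto
  qed
  also have "\<dots> = card {(r, s). (r, s) \<in> SF n \<and> r + 1 \<le> s \<and> ?P (?row (r, s), Suc s - r - 1)}"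
    by (rule card_boxes_eq[OF T, symmetric])
  also have "\<dots> = card ({b \<in> SF n. is_barred (T b) \<and> left_eq T b}
      \<union> {b \<in> SF n. \<not> is_barred (T b) \<and> below_eq T b})"
  proof (intro arg_cong[where f = card] Set.set_eqI)
    fix b :: box
    obtain r s where b: "b = (r, s)" by (cases b)
    show "b \<in> {(r, s). (r, s) \<in> SF n \<and> r + 1 \<le> s \<and> ?P (?row (r, s), Suc s - r - 1)} \<longleftrightarrow>
        b \<in> {b \<in> SF n. is_barred (T b) \<and> left_eq T b} \<union> {b \<in> SF n. \<not> is_barred (T b) \<and> below_eq T b}"
    proof (cases "(r, s) \<in> SF n \<and> r < s")
      case True
      have parity: "even (?row (r, s)) \<longleftrightarrow> is_barred (T (r, s))"
        using is_barred_letter_of_row[of n "?row (r, s)"] letter[of "(r, s)"] True by simp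
      have "b \<in> {(r, s). (r, s) \<in> SF n \<and> r + 1 \<le> s \<and> ?P (?row (r, s), Suc s - r - 1)} \<longleftrightarrow>
          (left_eq T (r, s) \<or> below_eq T (r, s)) \<and>
          col_sum n ?A (?row (r, s)) (s - r) = (if is_barred (T (r, s)) then 0 else 1)"
        using True letter[of "(r, s)"] mem_diag_iff[OF T, of r s] parity unfolding b by auto
      also have "\<dots> \<longleftrightarrow> is_barred (T (r, s)) \<and> left_eq T (r, s) \<or> \<not> is_barred (T (r, s)) \<and> below_eq T (r, s)"
        using col_sum_at_box[OF T, of r s] not_left_eq_and_below_eq[OF T, of "(r, s)"] True by auto
      finally show ?thesis using True b by auto
    next
      case False
      then show ?thesis by (auto simp: b left_eq_def below_eq_def)
    qed
  qed
  also have "\<dots> = var_ST n T"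
    unfolding var_ST_eq[OF T] by (rule card_Un_disjoint) (use finite_SF[of n] in auto)
  finally show "ssi_UA n ?A = var_ST n T" .
qed

lemma sum_ST_set_eq_sum_UA_set:
  fixes t :: "'b :: comm_ring_1"
  shows "(\<Sum>T\<in>ST_set n. t ^ (var_ST n T + bar_ST n T) * (1 + t) ^ (str_ST n T - n))
    = (\<Sum>A\<in>UA_set n. t ^ (ssi_UA n A + bar_UA n A) * (1 + t) ^ neg_UA n A)"
  by (rule sum.reindex_bij_witness[of _ "ST_of_UA n" "UA_of_ST n"])
    (auto simp: ST_of_UA_of_ST UA_of_ST_of_UA ST_of_UA_in_ST_set UA_of_ST_in_UA_set UA_statistics)

theorem corollary6p8:
  fixes n :: nat and t :: "int poly"
  assumes "n \<ge> 1" and t: "t = [:0, 1:]"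
  shows "(1 + t) ^ (n ^ 2)
           = (\<Sum>T\<in>ST_set n. t ^ (var_ST n T + bar_ST n T) * (1 + t) ^ (str_ST n T - n))
       \<and> (\<Sum>T\<in>ST_set n. t ^ (var_ST n T + bar_ST n T) * (1 + t) ^ (str_ST n T - n))
           = (\<Sum>A\<in>UA_set n. t ^ (ssi_UA n A + bar_UA n A) * (1 + t) ^ neg_UA n A)
       \<and> (\<Sum>A\<in>UA_set n. t ^ (ssi_UA n A + bar_UA n A) * (1 + t) ^ neg_UA n A)
           = (\<Sum>C\<in>CM_set n. t ^ (ne_o_CM n C + se_e_CM n C + wgt_e_CM n C) * (1 + t) ^ ns_CM n C)"
proof (intro conjI)
  show "(1 + t) ^ (n ^ 2)
      = (\<Sum>T\<in>ST_set n. t ^ (var_ST n T + bar_ST n T) * (1 + t) ^ (str_ST n T - n))"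
    by (simp add: ST_weight_eq_prod sum_ST_set_box_wt)
qed (rule sum_ST_set_eq_sum_UA_set sum_UA_set_eq_sum_CM_set)+

end
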